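(* The polynomial function $\Delta_0$ is irreducible in $\Bbbk[\mathcal{L}]$.
   Context: Let $\Bbbk$ be an algebraically closed field of characteristic $p>2$, let $n\ge 1$, and assume $(p,n)\ne(3,1)$. Let $\mathcal{O}_n=\Bbbk[X_1,\ldots,X_n]/(X_1^p,\ldots,X_n^p)$, and let $x_i$ be the image of $X_i$. Let $\mathcal{L}=\mathrm{Der}(\mathcal{O}_n)$ be the Lie algebra of $\Bbbk$-linear derivations of $\mathcal{O}_n$, a free $\mathcal{O}_n$-module with basis $\partial_1,\ldots,\partial_n$, where $\partial_i(x_j)=\delta_{ij}$; for $D\in\mathcal{L}$ all powers $D^{p^k}$ (as endomorphisms of $\mathcal{O}_n$) again lie in $\mathcal{L}$. $\Bbbk[\mathcal{L}]$ denotes the algebra of polynomial functions on the vector space $\mathcal{L}$. Give $\mathcal{L}$ the $\mathbb{Z}$-grading $\mathcal{L}=\bigoplus_{i\ge-1}\mathcal{L}_i$ in which $x_1^{a_1}\cdots x_n^{a_n}\partial_j$ (with $0\le a_k\le p-1$) has degree $a_1+\cdots+a_n-1$, and give $\wedge^n\mathcal{L}$ (over $\Bbbk$) the induced grading $\bigoplus_{i\ge-n}(\wedge^n\mathcal{L})_i$, so that $(\wedge^n\mathcal{L})_{-n}=\Bbbk(\partial_1\wedge\cdots\wedge\partial_n)$. The function $\Delta_0\in\Bbbk[\mathcal{L}]$, homogeneous of degree $1+p+\cdots+p^{n-1}$, is defined by $$D\wedge D^p\wedge\cdots\wedge D^{p^{n-1}}\in\Delta_0(D)(\partial_1\wedge\cdots\wedge\partial_n)+\bigoplus_{i>-n}(\wedge^n\mathcal{L})_i\qquad(\forall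 D\in\mathcal{L}).$$ *)

theory Defs
  imports
    "HOL-Library.Poly_Mapping"
    "HOL-Library.Cardinality"
    "HOL-Computational_Algebra.Polynomial"
    "HOL-Algebra.Ring_Divisibility"
begin

section \<open>Polynomial functions on a vector space\<close>

text \<open>
  The \<open>k\<close>-subalgebra of all functions \<open>V \<rightarrow> k\<close> generated by the linear functionals.
\<close>

inductive_set polyfun :: "('k::field \<Rightarrow> 'v::ab_group_add \<Rightarrow> 'v) \<Rightarrow> ('v \<Rightarrow> 'k) set"
  for scale :: "'k \<Rightarrow> 'v \<Rightarrow> 'v"
  where
    const: "(\<lambda>_. c) \<in> polyfun scale"
  | linear: "Vector_Spaces.linear scale (*) f \<Longrightarrow> f \<in> polyfun scale"
  | add: "f \<in> polyfun scale \<Longrightarrow> g \<in> polyfun scale \<Longrightarrow> (\<lambda>x. f x + g x) \<in> polyfun scale"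
  | mult: "f \<in> polyfun scale \<Longrightarrow> g \<in> polyfun scale \<Longrightarrow> (\<lambda>x. f x * g x) \<in> polyfun scale"

definition polyfun_ring :: "('k::field \<Rightarrow> 'v::ab_group_add \<Rightarrow> 'v) \<Rightarrow> ('v \<Rightarrow> 'k) ring" where
  "polyfun_ring scale =
     \<lparr>carrier = polyfun scale, monoid.mult = (\<lambda>f g x. f x * g x), one = (\<lambda>_. 1),
      zero = (\<lambda>_. 0), add = (\<lambda>f g x. f x + g x)\<rparr>"


section \<open>The truncated polynomial algebra\<close>

text \<open>
  Polynomials in the variables \<open>X i\<close>, \<open>i :: 'n\<close>, are finitely supported functions from
  exponent vectors to \<open>'k\<close>. For a finite linearly ordered type \<open>'n\<close> the variables are
  \<open>X\<^sub>1, \<dots>, X\<^sub>n\<close> with \<open>n = CARD('n)\<close>, listed in the order of \<open>'n\<close>.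
\<close>

type_synonym ('n, 'k) mpoly = "('n \<Rightarrow>\<^sub>0 nat) \<Rightarrow>\<^sub>0 'k"

definition mp_var :: "'n \<Rightarrow> ('n, 'k::field) mpoly" where
  "mp_var i = Poly_Mapping.single (Poly_Mapping.single i 1) 1"

definition mp_const :: "'k \<Rightarrow> ('n, 'k::field) mpoly" where
  "mp_const c = Poly_Mapping.single 0 c"

global_interpretation mp_ideal: Modules.module "(*) :: ('n, 'k::field) mpoly \<Rightarrow> _"
  by unfold_locales (simp_all add: algebra_simps)

definition trunc_ideal :: "('n, 'k::field) mpoly set" where
  "trunc_ideal = mp_ideal.span (range (\<lambda>i. mp_var i ^ CHAR('k)))"

lemma trunc_ideal_add: "f \<in> trunc_ideal \<Longrightarrow> g \<in> trunc_ideal \<Longrightarrow> f + g \<in> trunc_ideal"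
  unfolding trunc_ideal_def by (rule mp_ideal.span_add)

lemma trunc_ideal_diff: "f \<in> trunc_ideal \<Longrightarrow> g \<in> trunc_ideal \<Longrightarrow> f - g \<in> trunc_ideal"
  unfolding trunc_ideal_def by (rule mp_ideal.span_diff)

lemma trunc_ideal_zero: "0 \<in> trunc_ideal"
  unfolding trunc_ideal_def by (rule mp_ideal.span_zero)

lemma trunc_ideal_neg: "f \<in> trunc_ideal \<Longrightarrow> - f \<in> trunc_ideal"
  unfolding trunc_ideal_def by (rule mp_ideal.span_neg)

lemma trunc_ideal_mult: "f \<in> trunc_ideal \<Longrightarrow> g * f \<in> trunc_ideal"
  unfolding trunc_ideal_def by (rule mp_ideal.span_scale)

lemma mp_var_power: "mp_var i ^ m = Poly_Mapping.single (Poly_Mapping.single i m) 1"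
  by (induction m) (simp_all add: mp_var_def mult_single single_add[symmetric] flip: single_one)

lemma trunc_ideal_lookup_0:
  assumes "f \<in> (trunc_ideal :: ('n, 'k::field_prime_char) mpoly set)"
  shows "Poly_Mapping.lookup f 0 = 0"
  using assms unfolding trunc_ideal_def
proof (induction rule: mp_ideal.span_induct_alt)
  case base
  then show ?case by simp
next
  case (step c x y)
  obtain i where x: "x = Poly_Mapping.single (Poly_Mapping.single i CHAR('k)) 1"
    using step(1) by (auto simp: mp_var_power)
  have "0 \<notin> Poly_Mapping.keys (c * x)"
  proof
    assume "0 \<in> Poly_Mapping.keys (c * x)"
    then obtain a b where ab: "0 = a + b" "b \<in> Poly_Mapping.keys x"
      using keys_mult[of c x] by blast
    then have "b = Poly_Mapping.single i CHAR('k)"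
      by (simp add: x)
    then have "Poly_Mapping.lookup (a + b) i \<ge> CHAR('k)"
      by (simp add: lookup_add)
    then show False
      using ab(1)[symmetric] CHAR_pos[where ?'a = 'k] by simp
  qed
  then show ?case
    using step(2) by (simp add: lookup_add in_keys_iff)
qed

quotient_type (overloaded) ('n, 'k) trunc_poly = "('n, 'k::field) mpoly" / "\<lambda>f g. f - g \<in> trunc_ideal"
proof (rule equivpI)
  show "reflp (\<lambda>f g :: ('n, 'k) mpoly. f - g \<in> trunc_ideal)"
    by (auto intro!: reflpI trunc_ideal_zero)
  show "symp (\<lambda>f g :: ('n, 'k) mpoly. f - g \<in> trunc_ideal)"
    by (rule sympI, subst minus_diff_eq[symmetric]) (simp only: trunc_ideal_neg)
  show "transp (\<lambda>f g :: ('n, 'k) mpoly. f - g \<in> trunc_ideal)"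
  proof (rule transpI)
    fix f g h :: "('n, 'k) mpoly"
    assume "f - g \<in> trunc_ideal" "g - h \<in> trunc_ideal"
    then have "(f - g) + (g - h) \<in> trunc_ideal"
      by (rule trunc_ideal_add)
    then show "f - h \<in> trunc_ideal"
      by simp
  qed
qed

instantiation trunc_poly :: (type, field_prime_char) comm_ring_1
begin

lift_definition zero_trunc_poly :: "('n, 'k::field_prime_char) trunc_poly" is 0 .

lift_definition one_trunc_poly :: "('n, 'k::field_prime_char) trunc_poly" is 1 .

lift_definition plus_trunc_poly ::
  "('n, 'k::field_prime_char) trunc_poly \<Rightarrow> ('n, 'k) trunc_poly \<Rightarrow> ('n, 'k) trunc_poly" is "(+)"
  by (simp only: add_diff_add trunc_ideal_add)

lift_definition minus_trunc_poly ::
  "('n, 'k::field_prime_char) trunc_poly \<Rightarrow> ('n, 'k) trunc_poly \<Rightarrow> ('n, 'k) trunc_poly" is "(-)"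
proof -
  fix f f' g g' :: "('n, 'k) mpoly"
  assume "f - f' \<in> trunc_ideal" "g - g' \<in> trunc_ideal"
  then have "(f - f') - (g - g') \<in> trunc_ideal"
    by (rule trunc_ideal_diff)
  then show "(f - g) - (f' - g') \<in> trunc_ideal"
    by (simp add: algebra_simps)
qed

lift_definition uminus_trunc_poly ::
  "('n, 'k::field_prime_char) trunc_poly \<Rightarrow> ('n, 'k) trunc_poly" is uminus
  by (simp only: minus_diff_minus trunc_ideal_neg)

lift_definition times_trunc_poly ::
  "('n, 'k::field_prime_char) trunc_poly \<Rightarrow> ('n, 'k) trunc_poly \<Rightarrow> ('n, 'k) trunc_poly" is "(*)"
proof -
  fix f f' g g' :: "('n, 'k) mpoly"
  assume "f - f' \<in> trunc_ideal" "g - g' \<in> trunc_ideal"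
  then have "g * (f - f') + f' * (g - g') \<in> trunc_ideal"
    by (intro trunc_ideal_add trunc_ideal_mult)
  then show "f * g - f' * g' \<in> trunc_ideal"
    by (simp add: algebra_simps)
qed

instance
proof
  fix f g h :: "('a, 'b) trunc_poly"
  show "f * g * h = f * (g * h)"
    by transfer (simp only: mult.assoc diff_self trunc_ideal_zero)
  show "f * g = g * f"
    by transfer (simp only: mult.commute diff_self trunc_ideal_zero)
  show "1 * f = f"
    by transfer (simp only: mult_1_left diff_self trunc_ideal_zero)
  show "f + g + h = f + (g + h)"
    by transfer (simp only: add.assoc diff_self trunc_ideal_zero)
  show "f + g = g + f"
    by transfer (simp only: add.commute diff_self trunc_ideal_zero)
  show "0 + f = f"
    by transfer (simp only: add_0_left diff_self trunc_ideal_zero)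
  show "- f + f = 0"
    by transfer (simp only: left_minus diff_self trunc_ideal_zero)
  show "f - g = f + - g"
    by transfer (simp only: diff_conv_add_uminus[symmetric] diff_self trunc_ideal_zero)
  show "(f + g) * h = f * h + g * h"
    by transfer (simp only: distrib_right diff_self trunc_ideal_zero)
  show "(0 :: ('a, 'b) trunc_poly) \<noteq> 1"
  proof (transfer, rule notI)
    assume "(0 :: ('a, 'b) mpoly) - 1 \<in> trunc_ideal"
    from trunc_ideal_lookup_0[OF this] show False
      by (simp add: lookup_one)
  qed
qed

end

lift_definition tp_var :: "'n \<Rightarrow> ('n, 'k::field_prime_char) trunc_poly" is mp_var .

lift_definition tp_const :: "'k \<Rightarrow> ('n, 'k::field_prime_char) trunc_poly" is mp_const .

definition tp_scale :: "'k \<Rightarrow> ('n, 'k::field_prime_char) trunc_poly \<Rightarrow> ('n, 'k) trunc_poly" where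
  "tp_scale c f = tp_const c * f"

lemma tp_const_add: "tp_const (a + b) = tp_const a + tp_const b"
  by transfer (simp add: mp_const_def single_add trunc_ideal_zero)

lemma tp_const_mult: "tp_const (a * b) = tp_const a * tp_const b"
  by transfer (simp add: mp_const_def mult_single trunc_ideal_zero)

lemma tp_const_1: "tp_const 1 = 1"
  by transfer (simp add: mp_const_def trunc_ideal_zero)

global_interpretation tp: vector_space "tp_scale :: 'k \<Rightarrow> ('n, 'k::field_prime_char) trunc_poly \<Rightarrow> _"
  by unfold_locales (simp_all add: tp_scale_def tp_const_add tp_const_mult tp_const_1 algebra_simps)

lemma tp_const_0: "tp_const 0 = 0"
  by transfer (simp add: mp_const_def trunc_ideal_zero)

lemma of_nat_trunc_poly: "of_nat m = (tp_const (of_nat m) :: ('n, 'k::field_prime_char) trunc_poly)"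
  by (induction m) (simp_all add: tp_const_add tp_const_1 tp_const_0)

lemma of_nat_CHAR_trunc_poly: "(of_nat CHAR('k) :: ('n, 'k::field_prime_char) trunc_poly) = 0"
  by (subst of_nat_trunc_poly) (simp add: tp_const_0)

lemma tp_scale_mult_left: "tp_scale c f * g = tp_scale c (f * g)"
  by (simp add: tp_scale_def mult.assoc)

lemma tp_scale_mult_right: "f * tp_scale c g = tp_scale c (f * g)"
  by (simp add: tp_scale_def mult.left_commute)

lifting_forget trunc_poly.lifting


section \<open>The Lie algebra of derivations\<close>

definition is_derivation ::
  "(('n, 'k::field_prime_char) trunc_poly \<Rightarrow> ('n, 'k) trunc_poly) \<Rightarrow> bool" where
  "is_derivation D \<longleftrightarrow>
     Vector_Spaces.linear tp_scale tp_scale D \<and> (\<forall>f g. D (f * g) = D f * g + f * D g)"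

lemma is_derivation_iff:
  "is_derivation D \<longleftrightarrow>
     (\<forall>f g. D (f + g) = D f + D g) \<and> (\<forall>c f. D (tp_scale c f) = tp_scale c (D f)) \<and>
     (\<forall>f g. D (f * g) = D f * g + f * D g)"
proof
  assume D: "is_derivation D"
  then interpret Vector_Spaces.linear tp_scale tp_scale D
    by (simp add: is_derivation_def)
  show "(\<forall>f g. D (f + g) = D f + D g) \<and> (\<forall>c f. D (tp_scale c f) = tp_scale c (D f)) \<and>
        (\<forall>f g. D (f * g) = D f * g + f * D g)"
    using D by (simp add: is_derivation_def add scale)
next
  assume "(\<forall>f g. D (f + g) = D f + D g) \<and> (\<forall>c f. D (tp_scale c f) = tp_scale c (D f)) \<and>
          (\<forall>f g. D (f * g) = D f * g + f * D g)"
  then show "is_derivation D"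
    unfolding is_derivation_def by (auto intro!: Vector_Spaces.linear.intro module_hom.intro
      module_hom_axioms.intro tp.vector_space_axioms tp.module_axioms)
qed

typedef (overloaded) ('n, 'k) witt =
  "{D :: ('n, 'k::field_prime_char) trunc_poly \<Rightarrow> ('n, 'k) trunc_poly. is_derivation D}"
  morphisms witt_apply Abs_witt
  by (rule exI[of _ "\<lambda>_. 0"]) (simp add: is_derivation_iff)

setup_lifting type_definition_witt

instantiation witt :: (type, field_prime_char) ab_group_add
begin

lift_definition zero_witt :: "('n, 'k::field_prime_char) witt" is "\<lambda>_. 0"
  by (simp add: is_derivation_iff)

lift_definition plus_witt :: "('n, 'k::field_prime_char) witt \<Rightarrow> ('n, 'k) witt \<Rightarrow> ('n, 'k) witt"
  is "\<lambda>D E f. D f + E f"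
  by (simp add: is_derivation_iff algebra_simps tp.scale_right_distrib)

lift_definition minus_witt :: "('n, 'k::field_prime_char) witt \<Rightarrow> ('n, 'k) witt \<Rightarrow> ('n, 'k) witt"
  is "\<lambda>D E f. D f - E f"
  by (simp add: is_derivation_iff algebra_simps tp.scale_right_diff_distrib)

lift_definition uminus_witt :: "('n, 'k::field_prime_char) witt \<Rightarrow> ('n, 'k) witt"
  is "\<lambda>D f. - D f"
  by (simp add: is_derivation_iff algebra_simps)

instance
  by standard (transfer, simp add: fun_eq_iff)+

end

lift_definition witt_mult ::
  "('n, 'k::field_prime_char) trunc_poly \<Rightarrow> ('n, 'k) witt \<Rightarrow> ('n, 'k) witt"
  is "\<lambda>g D f. g * D f"
  by (simp add: is_derivation_iff tp_scale_mult_left tp_scale_mult_right algebra_simps)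

lift_definition witt_scale :: "'k \<Rightarrow> ('n, 'k::field_prime_char) witt \<Rightarrow> ('n, 'k) witt"
  is "\<lambda>c D f. tp_scale c (D f)"
  by (simp add: is_derivation_iff tp_scale_mult_left tp_scale_mult_right tp.scale_right_distrib
      tp.scale_left_commute)

global_interpretation witt: vector_space "witt_scale :: 'k \<Rightarrow> ('n, 'k::field_prime_char) witt \<Rightarrow> _"
  by unfold_locales
    (transfer, simp add: fun_eq_iff tp.scale_right_distrib tp.scale_left_distrib)+

lemma derivation_funpow_Leibniz:
  assumes "is_derivation D"
  shows "(D ^^ m) (f * g) = (\<Sum>i\<le>m. of_nat (m choose i) * ((D ^^ i) f * (D ^^ (m - i)) g))"
proof (induction m)
  case (Suc m)
  interpret D: Vector_Spaces.linear tp_scale tp_scale D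
    using assms by (simp add: is_derivation_def)
  have mult: "D (u * v) = D u * v + u * D v" for u v
    using assms by (simp add: is_derivation_def)
  have D1: "D 1 = 0"
    using mult[of 1 1] by simp
  have of_nat: "D (of_nat c) = 0" for c
    by (induction c) (simp_all add: D.add D.zero D1)
  let ?t = "\<lambda>i j. (D ^^ i) f * (D ^^ j) g"
  have "(D ^^ Suc m) (f * g) =
      (\<Sum>i\<le>m. of_nat (m choose i) * (?t (Suc i) (m - i) + ?t i (Suc (m - i))))"
    by (simp add: Suc.IH D.sum of_nat mult)
  also have "\<dots> = (\<Sum>i\<le>m. of_nat (m choose i) * ?t (Suc i) (Suc m - Suc i))
      + (\<Sum>i\<le>m. of_nat (m choose i) * ?t i (Suc m - i))"
    unfolding sum.distrib[symmetric] distrib_left[symmetric]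
    by (intro sum.cong refl) (simp add: Suc_diff_le)
  also have "(\<Sum>i\<le>m. of_nat (m choose i) * ?t i (Suc m - i)) =
      (\<Sum>i\<le>Suc m. of_nat (m choose i) * ?t i (Suc m - i))"
    by (simp add: binomial_eq_0)
  also have "\<dots> = ?t 0 (Suc m)
      + (\<Sum>i\<le>m. of_nat (m choose Suc i) * ?t (Suc i) (Suc m - Suc i))"
    by (simp only: sum.atMost_Suc_shift binomial_n_0 of_nat_1 mult_1_left diff_zero)
  finally show ?case
    by (simp only: sum.atMost_Suc_shift binomial_Suc_Suc of_nat_add distrib_right sum.distrib
          binomial_n_0 of_nat_1 mult_1_left diff_zero add_ac)
qed simp

lemma is_derivation_funpow_CHAR:
  fixes D :: "('n, 'k::field_prime_char) trunc_poly \<Rightarrow> ('n, 'k) trunc_poly"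
  assumes "is_derivation D"
  shows "is_derivation (D ^^ CHAR('k))"
proof -
  have p: "Factorial_Ring.prime CHAR('k)"
    by (rule prime_CHAR_semidom) (simp add: CHAR_pos)
  have D: "D (f + g) = D f + D g" "D (tp_scale c f) = tp_scale c (D f)" for f g c
    using assms by (simp_all add: is_derivation_iff)
  have lin: "(D ^^ m) (f + g) = (D ^^ m) f + (D ^^ m) g"
    "(D ^^ m) (tp_scale c f) = tp_scale c ((D ^^ m) f)" for m f g c
    by (induction m) (simp_all add: D)
  have Leibniz: "(D ^^ CHAR('k)) (f * g) = (D ^^ CHAR('k)) f * g + f * (D ^^ CHAR('k)) g" for f g
  proof -
    let ?s = "\<lambda>i. of_nat (CHAR('k) choose i) * ((D ^^ i) f * (D ^^ (CHAR('k) - i)) g)"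
    have zero: "?s i = 0" if "i \<in> {..CHAR('k)} - {0, CHAR('k)}" for i
    proof -
      have "CHAR('k) dvd (CHAR('k) choose i)"
        using that p by (intro dvd_choose_prime) auto
      then obtain q where "CHAR('k) choose i = CHAR('k) * q" ..
      then show ?thesis
        by (simp add: of_nat_CHAR_trunc_poly)
    qed
    have "(D ^^ CHAR('k)) (f * g) = (\<Sum>i\<in>{0, CHAR('k)}. ?s i)"
      unfolding derivation_funpow_Leibniz[OF assms]
      by (rule sum.mono_neutral_right) (use zero in auto)
    also have "\<dots> = (D ^^ CHAR('k)) f * g + f * (D ^^ CHAR('k)) g"
      using CHAR_pos[where ?'a = 'k] by simp
    finally show ?thesis .
  qed
  show ?thesis
    by (simp add: is_derivation_iff lin Leibniz)
qed

lemma is_derivation_funpow_CHAR_power: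
  fixes D :: "('n, 'k::field_prime_char) trunc_poly \<Rightarrow> ('n, 'k) trunc_poly"
  assumes "is_derivation D"
  shows "is_derivation (D ^^ (CHAR('k) ^ m))"
proof (induction m)
  case (Suc m)
  from is_derivation_funpow_CHAR[OF this] show ?case
    by (simp add: funpow_mult mult.commute)
qed (use assms in simp)

lift_definition witt_ppow :: "('n, 'k::field_prime_char) witt \<Rightarrow> nat \<Rightarrow> ('n, 'k) witt"
  is "\<lambda>D m. D ^^ (CHAR('k) ^ m)"
  by (rule is_derivation_funpow_CHAR_power)

definition witt_partial :: "'n \<Rightarrow> ('n, 'k::field_prime_char) witt" where
  "witt_partial i = (THE D. \<forall>j. witt_apply D (tp_var j) = (if i = j then 1 else 0))"

definition witt_grade :: "int \<Rightarrow> ('n::finite, 'k::field_prime_char) witt set" where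
  "witt_grade d = witt.span
     {witt_mult (\<Prod>k\<in>UNIV. tp_var k ^ a k) (witt_partial j) | a j.
        (\<forall>k. a k \<le> CHAR('k) - 1) \<and> (\<Sum>k\<in>UNIV. int (a k)) - 1 = d}"

lifting_forget witt.lifting


section \<open>The exterior power\<close>

text \<open>
  The quotient of the free vector space on \<open>n\<close>-tuples of elements of \<open>L\<close> (families indexed by \<open>'n\<close>)
  by the relations making tuples multilinear and alternating.
\<close>

type_synonym ('n, 'k) free_tuples = "('n \<Rightarrow> ('n, 'k) witt) \<Rightarrow>\<^sub>0 'k"

definition ft_scale :: "'k \<Rightarrow> ('n, 'k::field_prime_char) free_tuples \<Rightarrow> ('n, 'k) free_tuples" where
  "ft_scale c = Poly_Mapping.map ((*) c)"

lemma lookup_ft_scale: "Poly_Mapping.lookup (ft_scale c f) x = c * Poly_Mapping.lookup f x"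
  by (simp add: ft_scale_def Poly_Mapping.map.rep_eq when_def)

global_interpretation ft: vector_space
    "ft_scale :: 'k \<Rightarrow> ('n, 'k::field_prime_char) free_tuples \<Rightarrow> _"
  by unfold_locales
    (auto intro!: poly_mapping_eqI simp: lookup_ft_scale lookup_add algebra_simps)

definition ext_relations :: "('n, 'k::field_prime_char) free_tuples set" where
  "ext_relations = ft.span
     ({Poly_Mapping.single (F(i := D + E)) 1 - Poly_Mapping.single (F(i := D)) 1
         - Poly_Mapping.single (F(i := E)) 1 | F i D E. True} \<union>
      {Poly_Mapping.single (F(i := witt_scale c D)) 1
         - ft_scale c (Poly_Mapping.single (F(i := D)) 1) | F i c D. True} \<union>
      {Poly_Mapping.single F 1 | F. \<exists>i j. i \<noteq> j \<and> F i = F j})"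

quotient_type (overloaded) ('n, 'k) witt_ext =
  "('n, 'k::field_prime_char) free_tuples" / "\<lambda>u v. u - v \<in> ext_relations"
proof (rule equivpI)
  show "reflp (\<lambda>u v :: ('n, 'k) free_tuples. u - v \<in> ext_relations)"
    by (auto intro!: reflpI ft.span_zero simp: ext_relations_def)
  show "symp (\<lambda>u v :: ('n, 'k) free_tuples. u - v \<in> ext_relations)"
    by (rule sympI, subst minus_diff_eq[symmetric]) (simp only: ext_relations_def ft.span_neg)
  show "transp (\<lambda>u v :: ('n, 'k) free_tuples. u - v \<in> ext_relations)"
  proof (rule transpI)
    fix f g h :: "('n, 'k) free_tuples"
    assume "f - g \<in> ext_relations" "g - h \<in> ext_relations"
    then have "(f - g) + (g - h) \<in> ext_relations"
      unfolding ext_relations_def by (rule ft.span_add)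
    then show "f - h \<in> ext_relations"
      by simp
  qed
qed

instantiation witt_ext :: (type, field_prime_char) ab_group_add
begin

lift_definition zero_witt_ext :: "('n, 'k::field_prime_char) witt_ext" is 0 .

lift_definition plus_witt_ext ::
  "('n, 'k::field_prime_char) witt_ext \<Rightarrow> ('n, 'k) witt_ext \<Rightarrow> ('n, 'k) witt_ext" is "(+)"
  by (simp only: add_diff_add ext_relations_def ft.span_add)

lift_definition minus_witt_ext ::
  "('n, 'k::field_prime_char) witt_ext \<Rightarrow> ('n, 'k) witt_ext \<Rightarrow> ('n, 'k) witt_ext" is "(-)"
proof -
  fix f f' g g' :: "('n, 'k) free_tuples"
  assume "f - f' \<in> ext_relations" "g - g' \<in> ext_relations"
  then have "(f - f') - (g - g') \<in> ext_relations"
    unfolding ext_relations_def by (rule ft.span_diff)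
  then show "(f - g) - (f' - g') \<in> ext_relations"
    by (simp add: algebra_simps)
qed

lift_definition uminus_witt_ext ::
  "('n, 'k::field_prime_char) witt_ext \<Rightarrow> ('n, 'k) witt_ext" is uminus
  by (simp only: minus_diff_minus ext_relations_def ft.span_neg)

instance
proof
  fix u v w :: "('a, 'b) witt_ext"
  show "u + v + w = u + (v + w)"
    by transfer (simp only: add.assoc diff_self ext_relations_def ft.span_zero)
  show "u + v = v + u"
    by transfer (simp only: add.commute diff_self ext_relations_def ft.span_zero)
  show "0 + u = u"
    by transfer (simp only: add_0_left diff_self ext_relations_def ft.span_zero)
  show "- u + u = 0"
    by transfer (simp only: left_minus diff_self ext_relations_def ft.span_zero)
  show "u - v = u + - v"
    by transfer (simp only: diff_conv_add_uminus[symmetric] diff_self ext_relations_def ft.span_zero)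
qed

end

lift_definition ext_scale :: "'k \<Rightarrow> ('n, 'k::field_prime_char) witt_ext \<Rightarrow> ('n, 'k) witt_ext"
  is ft_scale
  unfolding ext_relations_def
  by (simp add: ft.scale_right_diff_distrib[symmetric] ft.span_scale)

global_interpretation ext: vector_space
    "ext_scale :: 'k \<Rightarrow> ('n, 'k::field_prime_char) witt_ext \<Rightarrow> _"
proof
  fix c d :: 'k and u v :: "('n, 'k) witt_ext"
  show "ext_scale c (u + v) = ext_scale c u + ext_scale c v"
    by transfer (simp only: ft.scale_right_distrib diff_self ext_relations_def ft.span_zero)
  show "ext_scale (c + d) u = ext_scale c u + ext_scale d u"
    by transfer (simp only: ft.scale_left_distrib diff_self ext_relations_def ft.span_zero)
  show "ext_scale c (ext_scale d u) = ext_scale (c * d) u"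
    by transfer (simp only: ft.scale_scale diff_self ext_relations_def ft.span_zero)
  show "ext_scale 1 u = u"
    by transfer (simp only: ft.scale_one diff_self ext_relations_def ft.span_zero)
qed

lift_definition wedge :: "('n \<Rightarrow> ('n, 'k::field_prime_char) witt) \<Rightarrow> ('n, 'k) witt_ext"
  is "\<lambda>F. Poly_Mapping.single F 1" .

definition ext_grade :: "int \<Rightarrow> ('n::finite, 'k::field_prime_char) witt_ext set" where
  "ext_grade m = ext.span
     {wedge F | F. \<exists>d. (\<forall>i. F i \<in> witt_grade (d i)) \<and> (\<Sum>i\<in>UNIV. d i) = m}"


section \<open>The function \<open>\<Delta>\<^sub>0\<close>\<close>

text \<open>
  For the \<open>(r+1)\<close>-st element \<open>i\<close> of \<open>'n\<close> we have \<open>card {..<i} = r\<close>, so the first family below is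
  \<open>D, D\<^sup>p, \<dots>\<close> up to exponent \<open>p\<close> to the power \<open>n - 1\<close>.
\<close>

definition Delta0 :: "('n::{finite, linorder}, 'k::field_prime_char) witt \<Rightarrow> 'k" where
  "Delta0 D = (THE c.
     wedge (\<lambda>i. witt_ppow D (card {..<i})) - ext_scale c (wedge witt_partial)
       \<in> ext.span (\<Union>m \<in> {- int CARD('n)<..}. ext_grade m))"

end

theory Submission
  imports Defs "HOL-Analysis.Determinants" "HOL-Number_Theory.Cong"
begin

text \<open>
  \<open>\<Delta>\<^sub>0(D)\<close> is the determinant of the constant terms of the \<open>D\<^bsup>p\<^sup>i\<^esup>(x\<^sub>j)\<close>. On the torus of derivations
  \<open>\<Sum>\<^sub>j l\<^sub>j (1 + x\<^sub>j) \<partial>\<^sub>j\<close> it is the Moore determinant \<open>det (l\<^sub>j\<^bsup>p\<^sup>i\<^esup>)\<close>. Let \<open>\<Delta>\<^sub>0 = G H\<close>. The automorphisms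
  \<open>1 + x\<^sub>i \<mapsto> (1 + x\<^sub>i) (1 + t x\<^sub>j)\<close> preserve \<open>\<Delta>\<^sub>0\<close>, and their orbits are polynomial curves in \<open>t\<close>, so
  \<open>G\<close> and \<open>H\<close> are constant along them; comparing \<open>t = 0\<close> with \<open>t = 1\<close> shows that on the torus \<open>G\<close> and
  \<open>H\<close> are invariant under the transvections \<open>l\<^sub>i \<mapsto> l\<^sub>i - l\<^sub>j\<close>. One of them, say \<open>G\<close>, vanishes on a
  hyperplane \<open>l\<^sub>i = 0\<close>, hence on all hyperplanes over the prime field, which exhausts the degree of the
  Moore determinant. So \<open>H\<close> is constant and nonzero on the torus; in particular \<open>H(0) \<noteq> 0\<close>, and since
  \<open>\<Delta>\<^sub>0\<close> is homogeneous, \<open>H\<close> is constant.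
\<close>

section \<open>Polynomial functions\<close>

text \<open>In a finite field, \<open>1\<close> plus the product of all X - a takes only the value
  \<open>1\<close>, so it has no root although its degree is positive.\<close>

lemma infinite_UNIV_alg_closed_field: "infinite (UNIV :: 'k::alg_closed_field set)"
proof
  assume fin: "finite (UNIV :: 'k set)"
  define P :: "'k poly" where "P = (\<Prod>a\<in>UNIV. [:- a, 1:])"
  have deg: "degree P = CARD('k)"
    unfolding P_def using fin by (subst degree_prod_eq_sum_degree) auto
  have "degree (P + 1) = CARD('k)"
    using deg fin by (subst degree_add_eq_left) (auto simp: card_gt_0_iff)
  then have "degree (P + 1) > 0"
    using fin by (simp add: card_gt_0_iff)
  then obtain z where "poly (P + 1) z = 0"
    using alg_closed_imp_poly_has_root by blast
  moreover have "poly P z = 0"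
    unfolding P_def poly_prod using fin by (auto intro!: prod_zero)
  ultimately show False
    by simp
qed

lemma infinite_poly_vanish:
  fixes q :: "'k::field poly"
  assumes "infinite (UNIV :: 'k set)" "\<And>t. poly q t = 0"
  shows "q = 0"
  using assms poly_roots_finite[of q] by auto

lemma polyfun_sum: "(\<And>i. i \<in> A \<Longrightarrow> f i \<in> polyfun sc) \<Longrightarrow> (\<lambda>x. \<Sum>i\<in>A. f i x) \<in> polyfun sc"
  by (induction A rule: infinite_finite_induct) (auto intro: polyfun.intros)

lemma polyfun_prod: "(\<And>i. i \<in> A \<Longrightarrow> f i \<in> polyfun sc) \<Longrightarrow> (\<lambda>x. \<Prod>i\<in>A. f i x) \<in> polyfun sc"
  by (induction A rule: infinite_finite_induct) (auto intro: polyfun.intros)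

lemma polyfun_diff:
  assumes "f \<in> polyfun sc" "g \<in> polyfun sc"
  shows "(\<lambda>x. f x - g x) \<in> polyfun sc"
proof -
  have "(\<lambda>x. f x + (- 1) * g x) \<in> polyfun sc"
    by (intro polyfun.intros assms)
  then show ?thesis
    by simp
qed

text \<open>A linear functional turns the curve into a polynomial in \<open>t\<close>, and sums and
  products preserve this. All later arguments with roots and degrees go through such restrictions to
  one variable.\<close>

lemma polyfun_on_curve:
  fixes v :: "nat \<Rightarrow> 'v::ab_group_add"
  assumes "f \<in> polyfun sc"
  shows "\<exists>q. \<forall>t. f (\<Sum>i\<in>I. sc (t ^ i) (v i)) = poly q t"
  using assms
proof induction
  case (const c)
  then show ?case
    by (intro exI[of _ "[:c:]"]) simp
next
  case (linear f)
  interpret f: Vector_Spaces.linear sc "(*)" f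
    by fact
  show ?case
    by (intro exI[of _ "\<Sum>i\<in>I. Polynomial.monom (f (v i)) i"])
      (simp add: f.sum f.scale poly_sum poly_monom mult.commute)
next
  case (add f g)
  then show ?case
    by (metis poly_add)
next
  case (mult f g)
  then show ?case
    by (metis poly_mult)
qed

lemma polyfun_on_line:
  fixes x y :: "'v::ab_group_add"
  assumes "vector_space sc" "f \<in> polyfun sc"
  obtains q where "\<And>t. f (x + sc t y) = poly q t"
proof -
  interpret vector_space sc by fact
  show ?thesis
    using polyfun_on_curve[OF assms(2), where I = "{..1}" and v = "\<lambda>i. if i = 0 then x else y"] that by auto
qed

text \<open>Join a point where \<open>f\<close> is nonzero to one where \<open>g\<close> is nonzero
  by a line; the restrictions are nonzero polynomials with product zero.\<close>

lemma polyfun_domain: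
  fixes f g :: "'v::ab_group_add \<Rightarrow> 'k::field"
  assumes "vector_space sc" "infinite (UNIV :: 'k set)"
    and "f \<in> polyfun sc" "g \<in> polyfun sc" "\<And>x. f x * g x = 0"
  shows "(\<forall>x. f x = 0) \<or> (\<forall>x. g x = 0)"
proof (rule ccontr)
  interpret vector_space sc by fact
  assume "\<not> ?thesis"
  then obtain x y where xy: "f x \<noteq> 0" "g y \<noteq> 0"
    by blast
  obtain p q where p: "\<And>t. f (x + sc t (y - x)) = poly p t"
    and q: "\<And>t. g (x + sc t (y - x)) = poly q t"
    using polyfun_on_line[OF assms(1,3)] polyfun_on_line[OF assms(1,4)] by metis
  have "poly (p * q) t = 0" for t
    using assms(5) by (simp flip: p q)
  then have "p * q = 0"
    by (rule infinite_poly_vanish[OF assms(2)])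
  moreover have "p \<noteq> 0" "q \<noteq> 0"
    using p[of 0] q[of 1] xy by auto
  ultimately show False
    by simp
qed

lemma polyfun_comp_linear:
  assumes "Vector_Spaces.linear scale1 scale2 h" "f \<in> polyfun scale2"
  shows "(\<lambda>x. f (h x)) \<in> polyfun scale1"
  using assms(2)
proof induction
  case (linear f)
  have "Vector_Spaces.linear scale1 (*) (f \<circ> h)"
    by (rule Vector_Spaces.linear_compose[OF assms(1) linear])
  then show ?case
    by (intro polyfun.linear) (simp add: o_def)
qed (auto intro: polyfun.intros)

text \<open>Over an infinite field the equality of values is one of polynomials, so the degrees of
  the factors add up to \<open>0\<close>. This makes factors constant along curves on which the
  product is a nonzero constant.\<close>

lemma poly_factors_of_const:
  fixes p q :: "'k::field poly"
  assumes "infinite (UNIV :: 'k set)" "\<And>t. poly p t * poly q t = c" "c \<noteq> 0"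
  shows "poly p s = poly p t"
proof -
  have "poly (p * q - [:c:]) t = 0" for t
    using assms(2) by simp
  then have pq: "p * q = [:c:]"
    using infinite_poly_vanish[OF assms(1)] by (metis eq_iff_diff_eq_0)
  then have "p \<noteq> 0" "q \<noteq> 0"
    using \<open>c \<noteq> 0\<close> by auto
  then have "degree p + degree q = 0"
    using pq by (metis degree_mult_eq degree_pCons_0)
  then obtain a where "p = [:a:]"
    by (meson add_is_0 degree_eq_zeroE)
  then show ?thesis
    by simp
qed

text \<open>Nonzero constants are units, and the zero \<open>y\<close> keeps \<open>F\<close> from
  being a unit, so it suffices that every factorisation has a constant factor.\<close>

lemma ring_irreducible_polyfunI:
  fixes F :: "'v::ab_group_add \<Rightarrow> 'k::field"
  assumes "F \<in> polyfun sc" "F x \<noteq> 0" "F y = 0"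
    and factors: "\<And>G H. G \<in> polyfun sc \<Longrightarrow> H \<in> polyfun sc \<Longrightarrow> (\<And>x. F x = G x * H x) \<Longrightarrow>
      (\<exists>c. \<forall>x. G x = c) \<or> (\<exists>c. \<forall>x. H x = c)"
  shows "ring_irreducible\<^bsub>polyfun_ring sc\<^esub> F"
  unfolding ring_irreducible_def irreducible_def
proof (intro conjI ballI impI)
  show "F \<noteq> \<zero>\<^bsub>polyfun_ring sc\<^esub>"
    using assms(2) by (auto simp: polyfun_ring_def)
  show "F \<notin> Units (polyfun_ring sc)"
  proof
    assume "F \<in> Units (polyfun_ring sc)"
    then obtain G where "(\<lambda>x. G x * F x) = (\<lambda>_. 1)"
      by (auto simp: polyfun_ring_def Units_def)
    from fun_cong[OF this, of y] show False
      using \<open>F y = 0\<close> by simp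
  qed
  fix G
  assume G: "G \<in> carrier (polyfun_ring sc)" "properfactor (polyfun_ring sc) G F"
  then obtain H where H: "H \<in> polyfun sc" "F = (\<lambda>x. G x * H x)"
    by (auto simp: properfactor_def factor_def polyfun_ring_def)
  from G have G1: "G \<in> polyfun sc" and nodvd: "\<not> F divides\<^bsub>polyfun_ring sc\<^esub> G"
    by (auto simp: properfactor_def polyfun_ring_def)
  \<comment> \<open>If the cofactor were constant, \<open>F\<close> and \<open>G\<close> would be
    associated and \<open>G\<close> would not be a proper factor.\<close>
  have nonconst_H: "\<not> (\<exists>c. \<forall>x. H x = c)"
  proof
    assume "\<exists>c. \<forall>x. H x = c"
    then obtain c where c: "\<And>x. H x = c"
      by blast
    then have "c \<noteq> 0"
      using assms(2) H(2) by auto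
    then have "G = (\<lambda>x. F x * inverse c)"
      by (simp add: H(2) c fun_eq_iff)
    then have "F divides\<^bsub>polyfun_ring sc\<^esub> G"
      unfolding factor_def polyfun_ring_def
      by (auto intro!: bexI[of _ "\<lambda>_. inverse c"] polyfun.const)
    with nodvd show False ..
  qed
  then obtain c where c: "\<And>x. G x = c"
    using factors[OF G1 H(1)] H(2) by auto
  then have "c \<noteq> 0"
    using assms(2) H(2) by auto
  with c show "G \<in> Units (polyfun_ring sc)"
    using G1 unfolding Units_def polyfun_ring_def
    by (auto intro!: bexI[of _ "\<lambda>_. inverse c"] polyfun.const)
qed

section \<open>Constant terms and partial derivatives of truncated polynomials\<close>

lemma poly_mapping_add_induct [case_names zero single add]:
  fixes f :: "'a \<Rightarrow>\<^sub>0 'b::comm_monoid_add"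
  assumes "P 0" "\<And>a c. P (Poly_Mapping.single a c)" "\<And>f g. P f \<Longrightarrow> P g \<Longrightarrow> P (f + g)"
  shows "P f"
proof (induction f rule: update_induct)
  case const
  then show ?case by (rule assms(1))
next
  case (update f a b)
  have "Poly_Mapping.update a b f = f + Poly_Mapping.single a b"
    using update(1) by (intro poly_mapping_eqI)
      (auto simp: lookup_update lookup_add lookup_single when_def in_keys_iff)
  then show ?case
    using update assms by simp
qed

lemma lookup_mult_0:
  fixes f g :: "('n, 'k::field) mpoly"
  shows "Poly_Mapping.lookup (f * g) 0 = Poly_Mapping.lookup f 0 * Poly_Mapping.lookup g 0"
proof (induction f rule: poly_mapping_add_induct)
  case (single a c)
  show ?case
  proof (induction g rule: poly_mapping_add_induct)
    case (single b d)
    have "a + b = 0 \<longleftrightarrow> a = 0 \<and> b = 0"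
      by (auto simp: poly_mapping_eq_iff fun_eq_iff lookup_add)
    then show ?case
      by (simp add: mult_single lookup_single when_def)
  qed (simp_all add: lookup_add algebra_simps)
qed (simp_all add: lookup_add algebra_simps)

definition tp_monom :: "('n \<Rightarrow> nat) \<Rightarrow> ('n::finite, 'k::field_prime_char) trunc_poly" where
  "tp_monom a = (\<Prod>k\<in>UNIV. tp_var k ^ a k)"

definition mp_pderiv :: "'n \<Rightarrow> ('n, 'k::field) mpoly \<Rightarrow> ('n, 'k) mpoly" where
  "mp_pderiv i f = Abs_poly_mapping (\<lambda>a. of_nat (Suc (Poly_Mapping.lookup a i)) *
     Poly_Mapping.lookup f (a + Poly_Mapping.single i 1))"

lemma lookup_mp_pderiv:
  "Poly_Mapping.lookup (mp_pderiv i f) a = of_nat (Suc (Poly_Mapping.lookup a i)) *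
     Poly_Mapping.lookup f (a + Poly_Mapping.single i 1)"
proof -
  have "finite ((\<lambda>a. a + Poly_Mapping.single i 1) -` Poly_Mapping.keys f)"
    by (intro finite_vimageI) (auto intro: injI)
  then have "finite {a. of_nat (Suc (Poly_Mapping.lookup a i)) *
      Poly_Mapping.lookup f (a + Poly_Mapping.single i 1) \<noteq> 0}"
    by (rule rev_finite_subset) (auto simp: in_keys_iff)
  then show ?thesis
    unfolding mp_pderiv_def by simp
qed

lemma mp_pderiv_add: "mp_pderiv i (f + g) = mp_pderiv i f + mp_pderiv i g"
  by (intro poly_mapping_eqI) (simp add: lookup_mp_pderiv lookup_add algebra_simps)

lemma mp_pderiv_0: "mp_pderiv i 0 = 0"
  by (intro poly_mapping_eqI) (simp add: lookup_mp_pderiv)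

text \<open>Subtraction of exponents is truncated. Where this matters, at exponent \<open>0\<close>
  of the variable \<open>i\<close>, the coefficient vanishes, so the wrong exponent carries
  nothing.\<close>

lemma mp_pderiv_single:
  "mp_pderiv i (Poly_Mapping.single a c) =
     Poly_Mapping.single (a - Poly_Mapping.single i 1) (of_nat (Poly_Mapping.lookup a i) * c)"
proof (intro poly_mapping_eqI)
  fix b
  show "Poly_Mapping.lookup (mp_pderiv i (Poly_Mapping.single a c)) b = Poly_Mapping.lookup
      (Poly_Mapping.single (a - Poly_Mapping.single i 1) (of_nat (Poly_Mapping.lookup a i) * c)) b"
  proof (cases "Poly_Mapping.lookup a i = 0")
    case True
    then have "a \<noteq> b + Poly_Mapping.single i 1"
      by (auto simp: lookup_add)
    with True show ?thesis
      by (simp add: lookup_mp_pderiv lookup_single when_def)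
  next
    case False
    then have eq: "a = b + Poly_Mapping.single i 1 \<longleftrightarrow> a - Poly_Mapping.single i 1 = b"
      by (auto simp: poly_mapping_eq_iff fun_eq_iff lookup_add lookup_minus lookup_single when_def)
    show ?thesis
    proof (cases "a = b + Poly_Mapping.single i 1")
      case True
      then show ?thesis
        by (simp add: lookup_mp_pderiv lookup_add)
    next
      case False
      with eq show ?thesis
        by (simp add: lookup_mp_pderiv lookup_single when_def)
    qed
  qed
qed

lemma mp_pderiv_mult: "mp_pderiv i (f * g) = mp_pderiv i f * g + f * mp_pderiv i g"
proof (induction f rule: poly_mapping_add_induct)
  case (single a c)
  show ?case
  proof (induction g rule: poly_mapping_add_induct)
    case (single b d)
    let ?e = "Poly_Mapping.single i (1::nat)"
    have "Poly_Mapping.single (a + b - ?e) (of_nat (Poly_Mapping.lookup a i) * (c * d)) =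
        Poly_Mapping.single (a - ?e + b) (of_nat (Poly_Mapping.lookup a i) * (c * d))"
    proof (cases "Poly_Mapping.lookup a i = 0")
      case False
      then have "a + b - ?e = a - ?e + b"
        by (auto simp: poly_mapping_eq_iff fun_eq_iff lookup_add lookup_minus lookup_single when_def)
      then show ?thesis
        by simp
    qed simp
    moreover have "Poly_Mapping.single (a + b - ?e) (of_nat (Poly_Mapping.lookup b i) * (c * d)) =
        Poly_Mapping.single (a + (b - ?e)) (of_nat (Poly_Mapping.lookup b i) * (c * d))"
    proof (cases "Poly_Mapping.lookup b i = 0")
      case False
      then have "a + b - ?e = a + (b - ?e)"
        by (auto simp: poly_mapping_eq_iff fun_eq_iff lookup_add lookup_minus lookup_single when_def)
      then show ?thesis
        by simp
    qed simp
    ultimately show ?case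
      by (simp add: mult_single mp_pderiv_single lookup_add single_add algebra_simps)
  qed (simp_all add: mp_pderiv_add mp_pderiv_0 algebra_simps)
qed (simp_all add: mp_pderiv_add mp_pderiv_0 algebra_simps)

text \<open>Partial derivatives kill the generators, which are p-th powers in characteristic p, so
  by the product rule they only act on the coefficients of the generators.\<close>

lemma mp_pderiv_trunc_ideal:
  fixes f :: "('n, 'k::field) mpoly"
  assumes "f \<in> trunc_ideal"
  shows "mp_pderiv i f \<in> trunc_ideal"
  using assms unfolding trunc_ideal_def
proof (induction rule: mp_ideal.span_induct_alt)
  case base
  then show ?case
    by (simp add: mp_pderiv_0 mp_ideal.span_zero)
next
  case (step g x f)
  then obtain j where x: "x = mp_var j ^ CHAR('k)"
    by auto
  have "mp_pderiv i x = 0"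
    unfolding x mp_var_power mp_pderiv_single by (simp add: lookup_single when_def)
  then have "mp_pderiv i (g * x + f) = mp_pderiv i g * x + mp_pderiv i f"
    by (simp add: mp_pderiv_add mp_pderiv_mult)
  then show ?case
    using step by (auto intro: mp_ideal.span_add mp_ideal.span_scale mp_ideal.span_base)
qed

section \<open>The quotient algebra: value at the origin, partial derivatives, monomials\<close>

context
  includes trunc_poly.lifting
begin

lemmas [transfer_rule] = zero_trunc_poly.transfer one_trunc_poly.transfer plus_trunc_poly.transfer
  times_trunc_poly.transfer tp_var.transfer tp_const.transfer
  trunc_poly.rel_eq_transfer trunc_poly.bi_total

text \<open>This is the residue map of the local algebra: evaluation at its only point, the
  origin.\<close>

lift_definition tp_eval0 :: "('n, 'k::field_prime_char) trunc_poly \<Rightarrow> 'k"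
  is "\<lambda>f. Poly_Mapping.lookup f 0"
  using trunc_ideal_lookup_0 by (fastforce simp: lookup_minus)

lemma tp_eval0_add: "tp_eval0 (f + g) = tp_eval0 f + tp_eval0 g"
  by transfer (simp add: lookup_add)

lemma tp_eval0_mult: "tp_eval0 (f * g) = tp_eval0 f * tp_eval0 g"
  by transfer (rule lookup_mult_0)

lemma tp_eval0_1: "tp_eval0 1 = 1"
  by transfer (simp add: lookup_one)

lemma tp_eval0_const: "tp_eval0 (tp_const c) = c"
  by transfer (simp add: mp_const_def)

lemma tp_eval0_var: "tp_eval0 (tp_var i) = 0"
  by transfer (auto simp: mp_var_def lookup_single when_def poly_mapping_eq_iff fun_eq_iff)

text \<open>These maps supply existence for the definite description in \<open>witt_partial\<close>;
  uniqueness is \<open>witt_eqI\<close>.\<close>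

lift_definition tp_pderiv :: "'n \<Rightarrow> ('n, 'k::field_prime_char) trunc_poly \<Rightarrow> ('n, 'k) trunc_poly"
  is mp_pderiv
proof -
  fix i and f g :: "('n, 'k) mpoly"
  assume "f - g \<in> trunc_ideal"
  moreover have "mp_pderiv i f - mp_pderiv i g = mp_pderiv i (f - g)"
    using mp_pderiv_add[of i "f - g" g] by simp
  ultimately show "mp_pderiv i f - mp_pderiv i g \<in> trunc_ideal"
    using mp_pderiv_trunc_ideal by metis
qed

lemma tp_pderiv_const: "tp_pderiv i (tp_const c) = 0"
  by transfer (simp add: mp_const_def mp_pderiv_single trunc_ideal_zero)

lemma tp_pderiv_add: "tp_pderiv i (f + g) = tp_pderiv i f + tp_pderiv i g"
  by transfer (simp add: mp_pderiv_add trunc_ideal_zero)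

lemma tp_pderiv_mult: "tp_pderiv i (f * g) = tp_pderiv i f * g + f * tp_pderiv i g"
  by transfer (simp add: mp_pderiv_mult trunc_ideal_zero)

lemma tp_pderiv_var: "tp_pderiv i (tp_var j) = (if i = j then 1 else 0)"
  by transfer (auto simp: mp_var_def mp_pderiv_single trunc_ideal_zero lookup_single)

lemma abs_trunc_poly_power: "abs_trunc_poly (f ^ m) = abs_trunc_poly f ^ m"
  by (induction m) (simp_all flip: one_trunc_poly_def times_trunc_poly.abs_eq)

lemma abs_trunc_poly_prod: "abs_trunc_poly (\<Prod>i\<in>A. f i) = (\<Prod>i\<in>A. abs_trunc_poly (f i))"
  by (induction A rule: infinite_finite_induct)
    (simp_all flip: one_trunc_poly_def times_trunc_poly.abs_eq)

lemma tp_var_power_CHAR: "(tp_var i :: ('n, 'k::field_prime_char) trunc_poly) ^ CHAR('k) = 0"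
proof -
  have "mp_var i ^ CHAR('k) \<in> (trunc_ideal :: ('n, 'k) mpoly set)"
    unfolding trunc_ideal_def by (intro mp_ideal.span_base) auto
  then have "abs_trunc_poly (mp_var i ^ CHAR('k)) = (0 :: ('n, 'k) trunc_poly)"
    unfolding zero_trunc_poly_def by (simp add: trunc_poly.abs_eq_iff)
  then show ?thesis
    by (simp add: abs_trunc_poly_power tp_var.abs_eq)
qed

lemma abs_trunc_poly_single:
  "abs_trunc_poly (Poly_Mapping.single a c) =
     tp_scale c (tp_monom (Poly_Mapping.lookup a) :: ('n::finite, 'k::field_prime_char) trunc_poly)"
proof -
  have prod: "(\<Prod>k\<in>A. mp_var k ^ Poly_Mapping.lookup a k) =
      (Poly_Mapping.single (\<Sum>k\<in>A. Poly_Mapping.single k (Poly_Mapping.lookup a k)) 1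
        :: ('n, 'k) mpoly)" for A
    by (induction A rule: infinite_finite_induct) (simp_all add: mp_var_power mult_single)
  have "(\<Sum>k\<in>UNIV. Poly_Mapping.single k (Poly_Mapping.lookup a k)) = a"
    by (intro poly_mapping_eqI) (simp add: lookup_sum lookup_single when_def)
  then have "Poly_Mapping.single a c =
      (mp_const c * (\<Prod>k\<in>UNIV. mp_var k ^ Poly_Mapping.lookup a k) :: ('n, 'k) mpoly)"
    unfolding prod by (simp add: mp_const_def mult_single)
  then show ?thesis
    by (simp add: tp_scale_def tp_monom_def tp_const.abs_eq tp_var.abs_eq abs_trunc_poly_prod
        abs_trunc_poly_power flip: times_trunc_poly.abs_eq)
qed

lemma tp_monom_eq_0:
  fixes a :: "'n::finite \<Rightarrow> nat"
  assumes "a k \<ge> CHAR('k)"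
  shows "tp_monom a = (0 :: ('n, 'k::field_prime_char) trunc_poly)"
proof -
  have "tp_var k ^ a k = (tp_var k ^ CHAR('k) * tp_var k ^ (a k - CHAR('k)) :: ('n, 'k) trunc_poly)"
    using assms by (simp flip: power_add)
  then have "tp_var k ^ a k = (0 :: ('n, 'k) trunc_poly)"
    by (simp add: tp_var_power_CHAR)
  then show ?thesis
    unfolding tp_monom_def by (subst prod.remove[of _ k]) auto
qed

definition tp_monoms :: "('n::finite, 'k::field_prime_char) trunc_poly set" where
  "tp_monoms = {tp_monom a | a. \<forall>k. a k \<le> CHAR('k) - 1}"

text \<open>All monomials span, and those with an exponent of at least p are zero in the
  quotient.\<close>

lemma span_tp_monoms: "f \<in> tp.span (tp_monoms :: ('n::finite, 'k::field_prime_char) trunc_poly set)"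
proof (induction f rule: trunc_poly.abs_induct)
  case (1 r)
  show ?case
  proof (induction r rule: poly_mapping_add_induct)
    case zero
    show ?case
      by (simp flip: zero_trunc_poly_def add: tp.span_zero)
  next
    case (single a c)
    show ?case
    proof (cases "\<forall>k. Poly_Mapping.lookup a k \<le> CHAR('k) - 1")
      case True
      then show ?thesis
        unfolding abs_trunc_poly_single tp_monoms_def
        by (intro tp.span_scale tp.span_base) auto
    next
      case False
      then obtain k where "CHAR('k) - 1 < Poly_Mapping.lookup a k"
        by (auto simp: not_le)
      then have "CHAR('k) \<le> Poly_Mapping.lookup a k"
        by linarith
      then show ?thesis
        unfolding abs_trunc_poly_single by (simp add: tp_monom_eq_0 tp.span_zero)
    qed
  next
    case (add f g)
    then show ?case
      by (simp flip: plus_trunc_poly.abs_eq add: tp.span_add)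
  qed
qed

end

lemma finite_tp_monoms: "finite (tp_monoms :: ('n::finite, 'k::field_prime_char) trunc_poly set)"
proof -
  have "finite (UNIV \<rightarrow>\<^sub>E {..CHAR('k) - 1} :: ('n \<Rightarrow> nat) set)"
    by (intro finite_PiE) auto
  moreover have "tp_monoms = (tp_monom :: _ \<Rightarrow> ('n, 'k) trunc_poly) ` (UNIV \<rightarrow>\<^sub>E {..CHAR('k) - 1})"
    by (auto simp: tp_monoms_def PiE_UNIV_domain)
  ultimately show ?thesis
    by (metis finite_imageI)
qed

section \<open>Derivations of the truncated polynomial algebra\<close>

lemma is_derivation_witt_apply: "is_derivation (witt_apply D)"
  using witt_apply by blast

lemma witt_apply_add_right: "witt_apply D (f + g) = witt_apply D f + witt_apply D g"
  and witt_apply_scale_right: "witt_apply D (tp_scale c f) = tp_scale c (witt_apply D f)"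
  and witt_apply_mult: "witt_apply D (f * g) = witt_apply D f * g + f * witt_apply D g"
  using is_derivation_witt_apply[of D] by (auto simp: is_derivation_iff)

lemma tp_eval0_0: "tp_eval0 0 = 0"
  using tp_eval0_add[of 0 0] by (metis add_0_left add_cancel_right_left)

lemma witt_apply_0_right: "witt_apply D 0 = 0"
  using witt_apply_scale_right[of D 0 0] by simp

lemma witt_apply_1: "witt_apply D 1 = 0"
  using witt_apply_mult[of D 1 1] by simp

lemma witt_apply_sum_left: "witt_apply (\<Sum>i\<in>A. D i) f = (\<Sum>i\<in>A. witt_apply (D i) f)"
  by (induction A rule: infinite_finite_induct) (simp_all add: zero_witt.rep_eq plus_witt.rep_eq)

lemma witt_apply_sum_right: "witt_apply D (\<Sum>i\<in>A. f i) = (\<Sum>i\<in>A. witt_apply D (f i))"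
  by (induction A rule: infinite_finite_induct)
    (simp_all add: witt_apply_0_right witt_apply_add_right)

lemma vector_space_field: "vector_space ((*) :: 'k::field \<Rightarrow> 'k \<Rightarrow> 'k)"
  by unfold_locales (simp_all add: algebra_simps)

lemma linear_witt_apply_left:
  "Vector_Spaces.linear witt_scale tp_scale (\<lambda>D. witt_apply D f)"
  by (simp add: Vector_Spaces.linear_iff tp.vector_space_axioms witt.vector_space_axioms
      plus_witt.rep_eq witt_scale.rep_eq)

lemma tp_eval0_scale: "tp_eval0 (tp_scale c f) = c * tp_eval0 f"
  by (simp add: tp_scale_def tp_eval0_mult tp_eval0_const)

text \<open>The elements on which two derivations agree form a subspace that is closed under
  products and contains \<open>1\<close> and the variables, hence all monomials.\<close>

lemma witt_eqI:
  fixes D E :: "('n::finite, 'k::field_prime_char) witt"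
  assumes "\<And>j. witt_apply D (tp_var j) = witt_apply E (tp_var j)"
  shows "D = E"
proof -
  let ?S = "{f. witt_apply D f = witt_apply E f}"
  have one: "1 \<in> ?S"
    by (simp add: witt_apply_1)
  have mult: "f * g \<in> ?S" if "f \<in> ?S" "g \<in> ?S" for f g
    using that by (simp add: witt_apply_mult)
  have "tp_var j ^ m \<in> ?S" for j m
    by (induction m) (simp_all add: assms witt_apply_1 witt_apply_mult)
  then have "(\<Prod>j\<in>A. tp_var j ^ a j) \<in> ?S" for a A
    by (induction A rule: infinite_finite_induct)
      (simp_all only: prod.infinite prod.empty prod.insert one mult not_False_eq_True)
  then have "tp_monoms \<subseteq> ?S"
    by (auto simp: tp_monoms_def tp_monom_def)
  moreover have "tp.subspace ?S"
    by (auto simp: tp.subspace_def witt_apply_0_right witt_apply_add_right witt_apply_scale_right)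
  ultimately have "tp.span tp_monoms \<subseteq> ?S"
    by (rule tp.span_minimal)
  then have "witt_apply D f = witt_apply E f" for f
    using span_tp_monoms[of f] by blast
  then show ?thesis
    by (simp add: witt_apply_inject[symmetric] fun_eq_iff)
qed

lemma witt_partial_var:
  "witt_apply (witt_partial i :: ('n::finite, 'k::field_prime_char) witt) (tp_var j) =
     (if i = j then 1 else 0)"
proof -
  have "is_derivation (tp_pderiv i :: ('n, 'k) trunc_poly \<Rightarrow> _)"
    by (simp add: is_derivation_iff tp_pderiv_add tp_pderiv_mult tp_scale_def tp_pderiv_const)
  then have ex: "witt_apply (Abs_witt (tp_pderiv i :: ('n, 'k) trunc_poly \<Rightarrow> _)) (tp_var j) =
      (if i = j then 1 else 0)" for j
    by (simp add: Abs_witt_inverse tp_pderiv_var)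
  have "\<exists>!D :: ('n, 'k) witt. \<forall>j. witt_apply D (tp_var j) = (if i = j then 1 else 0)"
    by (rule ex1I[of _ "Abs_witt (tp_pderiv i)"]) (auto simp: ex intro!: witt_eqI)
  from theI'[OF this] show ?thesis
    unfolding witt_partial_def by blast
qed

lemma witt_expand:
  fixes D :: "('n::finite, 'k::field_prime_char) witt"
  shows "D = (\<Sum>j\<in>UNIV. witt_mult (witt_apply D (tp_var j)) (witt_partial j))"
  by (rule witt_eqI)
    (simp add: witt_apply_sum_left witt_mult.rep_eq witt_partial_var if_distrib cong: if_cong)

lemma witt_mult_add_left: "witt_mult (f + g) D = witt_mult f D + witt_mult g D"
  and witt_mult_scale_left: "witt_mult (tp_scale c f) D = witt_scale c (witt_mult f D)"
  and witt_mult_0_left: "witt_mult 0 D = 0"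
  and witt_mult_1_left: "witt_mult 1 D = D"
  by (simp_all add: witt_apply_inject[symmetric] fun_eq_iff witt_mult.rep_eq plus_witt.rep_eq
      zero_witt.rep_eq witt_scale.rep_eq algebra_simps tp_scale_mult_left)

definition witt_monoms :: "('n::finite, 'k::field_prime_char) witt set" where
  "witt_monoms = {witt_mult (tp_monom a) (witt_partial j) | a j. \<forall>k. a k \<le> CHAR('k) - 1}"

lemma span_witt_monoms:
  fixes D :: "('n::finite, 'k::field_prime_char) witt"
  shows "D \<in> witt.span witt_monoms"
proof -
  have "witt_mult f (witt_partial j) \<in> witt.span witt_monoms" for f :: "('n, 'k) trunc_poly" and j
    using span_tp_monoms[of f]
  proof (induction rule: tp.span_induct_alt)
    case base
    then show ?case
      by (simp add: witt_mult_0_left witt.span_zero)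
  next
    case (step c x y)
    then have "witt_mult x (witt_partial j) \<in> witt_monoms"
      by (auto simp: tp_monoms_def witt_monoms_def)
    with step show ?case
      unfolding witt_mult_add_left witt_mult_scale_left
      by (intro witt.span_add witt.span_scale) (auto intro: witt.span_base)
  qed
  then show ?thesis
    by (subst witt_expand) (intro witt.span_sum)
qed

text \<open>Powers of \<open>D\<close> are not linear in \<open>D\<close>, so one application is
  split off: \<open>witt_apply D f\<close> is expanded in a basis, with coordinates linear in
  \<open>D\<close>, and the other \<open>m\<close> applications act on fixed basis elements. Hence
  the induction is general in \<open>f\<close>.\<close>

lemma polyfun_eval0_funpow:
  fixes f :: "('n::finite, 'k::field_prime_char) trunc_poly"
  shows "(\<lambda>D. tp_eval0 ((witt_apply D ^^ m) f)) \<in> polyfun witt_scale"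
proof (induction m arbitrary: f)
  case 0
  then show ?case
    by (simp add: polyfun.const)
next
  case (Suc m)
  \<comment> \<open>A basis is chosen among the spanning monomials, so that coordinates are
    well-defined linear functionals.\<close>
  obtain B :: "('n, 'k) trunc_poly set"
    where B: "B \<subseteq> tp_monoms" "tp.independent B" "tp_monoms \<subseteq> tp.span B"
    by (rule tp.maximal_independent_subset)
  have fin: "finite B"
    using B(1) finite_tp_monoms by (rule finite_subset)
  have span: "g \<in> tp.span B" for g
    using tp.span_mono[OF B(3)] span_tp_monoms[of g] by (auto simp: tp.span_span)
  define r where "r = (\<lambda>b g. tp.representation B g b)"
  have expand: "g = (\<Sum>b\<in>B. tp_scale (r b g) b)" for g
    using tp.sum_representation_eq[OF B(2) span fin order_refl] by (simp add: r_def)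
  have lin: "Vector_Spaces.linear tp_scale (*) (r b)" for b
    unfolding r_def
    by (simp add: Vector_Spaces.linear_iff tp.vector_space_axioms vector_space_field
        tp.representation_add[OF B(2) span span] tp.representation_scale[OF B(2) span])
  have funpow_sum: "(witt_apply D ^^ m) (\<Sum>b\<in>B. tp_scale (c b) b) =
      (\<Sum>b\<in>B. tp_scale (c b) ((witt_apply D ^^ m) b))" for D c
    by (induction m) (simp_all add: witt_apply_sum_right witt_apply_scale_right)
  have eval0_sum: "tp_eval0 (\<Sum>b\<in>B. tp_scale (c b) (h b)) = (\<Sum>b\<in>B. c b * tp_eval0 (h b))" for c h
    by (induction B rule: infinite_finite_induct)
      (simp_all add: tp_eval0_0 tp_eval0_add tp_eval0_scale)
  have eq: "tp_eval0 ((witt_apply D ^^ Suc m) f) =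
      (\<Sum>b\<in>B. r b (witt_apply D f) * tp_eval0 ((witt_apply D ^^ m) b))" for D
    unfolding funpow_Suc_right o_apply
    by (subst expand[of "witt_apply D f"]) (simp only: funpow_sum eval0_sum)
  have "(\<lambda>D. r b (witt_apply D f)) \<in> polyfun witt_scale" for b
    using Vector_Spaces.linear_compose[OF linear_witt_apply_left lin]
    by (intro polyfun.linear) (simp add: o_def)
  then show ?case
    unfolding eq by (intro polyfun_sum polyfun.mult Suc.IH)
qed

section \<open>The determinant formula\<close>

text \<open>These are the coordinates of the component of degree \<open>-1\<close> of
  \<open>D\<close> with respect to the partial derivatives.\<close>

definition const_row :: "('n::finite, 'k::field_prime_char) witt \<Rightarrow> 'k ^ 'n" where
  "const_row D = (\<chi> j. tp_eval0 (witt_apply D (tp_var j)))"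

lemma const_row_add: "const_row (D + E) = const_row D + const_row E"
  and const_row_scale: "const_row (witt_scale c D) = c *s const_row D"
  and const_row_0: "const_row 0 = 0"
  by (simp_all add: const_row_def vec_eq_iff plus_witt.rep_eq witt_scale.rep_eq zero_witt.rep_eq
      tp_eval0_add tp_eval0_scale tp_eval0_0)

lemma const_row_partial: "const_row (witt_partial i) = axis i 1"
  by (simp add: const_row_def vec_eq_iff witt_partial_var axis_def tp_eval0_1 tp_eval0_0)

lemma tp_eval0_monom:
  fixes a :: "'n::finite \<Rightarrow> nat"
  assumes "a k > 0"
  shows "tp_eval0 (tp_monom a :: ('n, 'k::field_prime_char) trunc_poly) = 0"
proof -
  have "tp_eval0 (\<Prod>i\<in>A. f i) = (\<Prod>i\<in>A. tp_eval0 (f i :: ('n, 'k) trunc_poly))"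
    for f and A :: "'n set"
    by (induction A rule: infinite_finite_induct) (simp_all add: tp_eval0_mult tp_eval0_1)
  moreover have "tp_eval0 (tp_var k ^ a k :: ('n, 'k) trunc_poly) = 0"
    using assms by (cases "a k") (simp_all add: tp_eval0_mult tp_eval0_var)
  ultimately show ?thesis
    unfolding tp_monom_def by (auto intro: prod_zero)
qed

text \<open>In degree at least \<open>0\<close> the exponents of a monomial coefficient add up to at
  least \<open>1\<close>, so the coefficient vanishes at the origin.\<close>

lemma const_row_grade:
  fixes D :: "('n::finite, 'k::field_prime_char) witt"
  assumes "D \<in> witt_grade d" "d \<ge> 0"
  shows "const_row D = 0"
proof -
  have "witt_grade d \<subseteq> {D :: ('n, 'k) witt. const_row D = 0}"
    unfolding witt_grade_def
  proof (intro witt.span_minimal)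
    show "witt.subspace {D :: ('n, 'k) witt. const_row D = 0}"
      by (simp add: witt.subspace_def const_row_add const_row_scale const_row_0)
    show "{witt_mult (\<Prod>k\<in>UNIV. tp_var k ^ a k) (witt_partial j) | a j.
        (\<forall>k. a k \<le> CHAR('k) - 1) \<and> (\<Sum>k\<in>UNIV. int (a k)) - 1 = d} \<subseteq> {D :: ('n, 'k) witt. const_row D = 0}"
    proof
      fix X :: "('n, 'k) witt"
      assume "X \<in> {witt_mult (\<Prod>k\<in>UNIV. tp_var k ^ a k) (witt_partial j) | a j.
        (\<forall>k. a k \<le> CHAR('k) - 1) \<and> (\<Sum>k\<in>UNIV. int (a k)) - 1 = d}"
      then obtain a j where X: "X = witt_mult (\<Prod>k\<in>UNIV. tp_var k ^ a k) (witt_partial j)"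
        and d: "(\<Sum>k\<in>UNIV. int (a k)) - 1 = d"
        by blast
      from d \<open>d \<ge> 0\<close> have "(\<Sum>k\<in>UNIV. int (a k)) \<noteq> 0"
        by linarith
      then obtain k where "a k > 0"
        by (metis of_nat_0 bot_nat_0.not_eq_extremum sum.neutral)
      then have "tp_eval0 (\<Prod>k\<in>UNIV. tp_var k ^ a k :: ('n, 'k) trunc_poly) = 0"
        using tp_eval0_monom unfolding tp_monom_def by blast
      then show "X \<in> {D. const_row D = 0}"
        unfolding X by (simp add: const_row_def vec_eq_iff witt_mult.rep_eq tp_eval0_mult)
    qed
  qed
  with assms(1) show ?thesis
    by blast
qed

section \<open>The determinant as a functional on the exterior power\<close>

definition ft_det :: "('n::finite, 'k::field_prime_char) free_tuples \<Rightarrow> 'k" where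
  "ft_det u = (\<Sum>F\<in>Poly_Mapping.keys u. Poly_Mapping.lookup u F * det (\<chi> i. const_row (F i)))"

lemma ft_det_superset:
  assumes "finite K" "Poly_Mapping.keys u \<subseteq> K"
  shows "ft_det u = (\<Sum>F\<in>K. Poly_Mapping.lookup u F * det (\<chi> i. const_row (F i)))"
  unfolding ft_det_def by (rule sum.mono_neutral_left) (use assms in \<open>auto simp: in_keys_iff\<close>)

lemma ft_det_single: "ft_det (Poly_Mapping.single F c) = c * det (\<chi> i. const_row (F i))"
  by (subst ft_det_superset[of "{F}"]) auto

lemma ft_det_add: "ft_det (u + v) = ft_det u + ft_det v"
proof -
  let ?K = "Poly_Mapping.keys u \<union> Poly_Mapping.keys v"
  have "Poly_Mapping.keys (u + v) \<subseteq> ?K"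
    by (rule Poly_Mapping.keys_add)
  then show ?thesis
    by (simp add: ft_det_superset[of ?K] lookup_add distrib_right sum.distrib)
qed

lemma ft_det_scale: "ft_det (ft_scale c u) = c * ft_det u"
proof -
  have "Poly_Mapping.keys (ft_scale c u) \<subseteq> Poly_Mapping.keys u"
    by (auto simp: in_keys_iff lookup_ft_scale)
  then show ?thesis
    by (simp add: ft_det_superset[of "Poly_Mapping.keys u"] lookup_ft_scale sum_distrib_left mult.assoc)
qed

lemma ft_det_diff: "ft_det (u - v) = ft_det u - ft_det v"
  using ft_det_add[of "u - v" v] by simp

lemma const_row_fun_upd:
  "(\<chi> k. const_row ((F(i := D)) k)) = (\<chi> k. if k = i then const_row D else const_row (F k))"
  by (simp add: vec_eq_iff)

text \<open>The three families of relations express additivity, homogeneity and the alternating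
  property, all of which hold for determinants in their rows. Hence \<open>ft_det\<close> descends
  to the exterior power.\<close>

lemma ft_det_relations:
  fixes u :: "('n::finite, 'k::field_prime_char) free_tuples"
  assumes "u \<in> ext_relations"
  shows "ft_det u = 0"
proof -
  have "ext_relations \<subseteq> {u :: ('n, 'k) free_tuples. ft_det u = 0}"
    unfolding ext_relations_def
  proof (intro ft.span_minimal Un_least)
    show "ft.subspace {u :: ('n, 'k) free_tuples. ft_det u = 0}"
      by (simp add: ft.subspace_def ft_det_add ft_det_scale ft_det_def[of 0])
    show "{Poly_Mapping.single (F(i := D + E)) 1 - Poly_Mapping.single (F(i := D)) 1
         - Poly_Mapping.single (F(i := E)) 1 | F i D E. True} \<subseteq> {u :: ('n, 'k) free_tuples. ft_det u = 0}"
      by (auto simp: ft_det_diff ft_det_single const_row_fun_upd const_row_add det_row_add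
          simp del: fun_upd_apply cong: if_cong)
    show "{Poly_Mapping.single (F(i := witt_scale c D)) 1
         - ft_scale c (Poly_Mapping.single (F(i := D)) 1) | F i c D. True}
         \<subseteq> {u :: ('n, 'k) free_tuples. ft_det u = 0}"
      by (auto simp: ft_det_diff ft_det_scale ft_det_single const_row_fun_upd const_row_scale
          det_row_mul simp del: fun_upd_apply cong: if_cong)
    show "{Poly_Mapping.single F 1 | F. \<exists>i j. i \<noteq> j \<and> F i = F j}
         \<subseteq> {u :: ('n, 'k) free_tuples. ft_det u = 0}"
      by (auto simp: ft_det_single row_def intro!: det_identical_rows)
  qed
  with assms show ?thesis
    by blast
qed

lift_definition ext_det :: "('n::finite, 'k::field_prime_char) witt_ext \<Rightarrow> 'k" is ft_det
  using ft_det_relations by (fastforce simp: ft_det_diff)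

lemma ext_det_wedge: "ext_det (wedge F) = det (\<chi> i. const_row (F i))"
  by transfer (simp add: ft_det_single)

lemma ext_det_add: "ext_det (u + v) = ext_det u + ext_det v"
  by transfer (rule ft_det_add)

lemma ext_det_scale: "ext_det (ext_scale c u) = c * ext_det u"
  by transfer (rule ft_det_scale)

lemma ext_det_diff: "ext_det (u - v) = ext_det u - ext_det v"
  using ext_det_add[of "u - v" v] by simp

lemma ext_det_partial: "ext_det (wedge witt_partial :: ('n::finite, 'k::field_prime_char) witt_ext) = 1"
proof -
  have "(\<chi> i. axis i 1) = (mat 1 :: 'k ^ 'n ^ 'n)"
    by (auto simp: vec_eq_iff axis_def mat_def)
  then show ?thesis
    by (simp add: ext_det_wedge const_row_partial)
qed

definition ext_higher :: "('n::finite, 'k::field_prime_char) witt_ext set" where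
  "ext_higher = ext.span (\<Union>m \<in> {- int CARD('n)<..}. ext_grade m)"

text \<open>If all n degrees were negative, their sum would be at most -n. So some factor has degree
  at least \<open>0\<close> and contributes a zero row.\<close>

lemma ext_det_higher:
  fixes w :: "('n::finite, 'k::field_prime_char) witt_ext"
  assumes "w \<in> ext_higher"
  shows "ext_det w = 0"
proof -
  have subspace: "ext.subspace {w :: ('n, 'k) witt_ext. ext_det w = 0}"
    using ext_det_scale[of 0 0] by (simp add: ext.subspace_def ext_det_add ext_det_scale)
  have "ext_det (wedge F) = 0"
    if "\<forall>i. F i \<in> witt_grade (d i)" "(\<Sum>i\<in>UNIV. d i) > - int CARD('n)"
    for F :: "'n \<Rightarrow> ('n, 'k) witt" and d
  proof -
    have "\<exists>i. d i \<ge> 0"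
    proof (rule ccontr)
      assume "\<nexists>i. d i \<ge> 0"
      then have neg: "d i < 0" for i
        by (simp add: not_le)
      have "d i \<le> - 1" for i
        using neg[of i] by linarith
      then have "(\<Sum>i\<in>UNIV. d i) \<le> (\<Sum>i\<in>(UNIV :: 'n set). - 1)"
        by (intro sum_mono)
      with that show False
        by simp
    qed
    then obtain i where "d i \<ge> 0" ..
    with that have "const_row (F i) = 0"
      by (intro const_row_grade) auto
    then show ?thesis
      unfolding ext_det_wedge by (intro det_zero_row(2)[of i]) (simp add: row_def vec_eq_iff)
  qed
  then have "ext_grade m \<subseteq> {w :: ('n, 'k) witt_ext. ext_det w = 0}" if "m > - int CARD('n)" for m
    unfolding ext_grade_def by (intro ext.span_minimal subspace) (use that in blast)
  then have "ext_higher \<subseteq> {w :: ('n, 'k) witt_ext. ext_det w = 0}"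
    unfolding ext_higher_def by (intro ext.span_minimal subspace) blast
  with assms show ?thesis
    by blast
qed

section \<open>Reduction of wedges modulo higher degree\<close>

lemma wedge_add: "wedge (F(i := D + E)) = wedge (F(i := D)) + wedge (F(i := E))"
proof (transfer, goal_cases)
  case (1 F i D E)
  have "Poly_Mapping.single (F(i := D + E)) 1 - Poly_Mapping.single (F(i := D)) 1
         - Poly_Mapping.single (F(i := E)) (1 :: 'b) \<in> ext_relations"
    unfolding ext_relations_def by (intro ft.span_base) blast
  then show ?case
    by (simp add: algebra_simps)
qed

lemma wedge_scale: "wedge (F(i := witt_scale c D)) = ext_scale c (wedge (F(i := D)))"
  by transfer (unfold ext_relations_def, intro ft.span_base, blast)

lemma wedge_eq_0: "i \<noteq> j \<Longrightarrow> F i = F j \<Longrightarrow> wedge F = 0"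
  by transfer (unfold ext_relations_def diff_zero, intro ft.span_base, blast)

lemma wedge_transpose:
  assumes "i \<noteq> j"
  shows "wedge (F \<circ> Transposition.transpose i j) = - wedge F"
proof -
  let ?W = "\<lambda>D E. wedge (F(i := D, j := E))"
  have add1: "?W (D + D') E = ?W D E + ?W D' E" for D D' E
    using wedge_add[of "F(j := E)" i D D'] assms by (simp add: fun_upd_twist)
  \<comment> \<open>Polarisation: equal entries give zero, and expanding the sum in both slots
    leaves the two mixed terms.\<close>
  have "0 = ?W (F i + F j) (F i + F j)"
    using assms by (intro wedge_eq_0[symmetric, of i j]) auto
  also have "\<dots> = ?W (F i) (F i) + ?W (F j) (F j) + ?W (F i) (F j) + ?W (F j) (F i)"
    by (simp only: add1 wedge_add add_ac)
  also have "?W (F i) (F i) = 0"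
    using assms by (intro wedge_eq_0[of i j]) auto
  also have "?W (F j) (F j) = 0"
    using assms by (intro wedge_eq_0[of i j]) auto
  also have "F(i := F i, j := F j) = F"
    by simp
  also have "F(i := F j, j := F i) = F \<circ> Transposition.transpose i j"
    by (auto simp: fun_eq_iff Transposition.transpose_def)
  finally show ?thesis
    by (simp add: eq_neg_iff_add_eq_0 add.commute o_def)
qed

text \<open>Multilinearity, one slot at a time: the induction is over the set \<open>A\<close> of
  slots whose entries may range over the whole span while the others stay in
  \<open>B\<close>.\<close>

lemma wedge_in_subspace_of_span:
  fixes F :: "'n::finite \<Rightarrow> ('n, 'k::field_prime_char) witt"
  assumes V: "ext.subspace V" and B: "\<And>F. (\<And>i. F i \<in> B) \<Longrightarrow> wedge F \<in> V"
    and F: "\<And>i. F i \<in> witt.span B"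
  shows "wedge F \<in> V"
proof -
  have "\<forall>F. (\<forall>i\<in>A. F i \<in> witt.span B) \<and> (\<forall>i. i \<notin> A \<longrightarrow> F i \<in> B) \<longrightarrow> wedge F \<in> V"
    if "finite A" for A
    using that
  proof induction
    case empty
    then show ?case
      using B by simp
  next
    case (insert a A)
    show ?case
    proof safe
      fix F :: "'n \<Rightarrow> ('n, 'k) witt"
      assume F: "\<forall>i\<in>insert a A. F i \<in> witt.span B" "\<forall>i. i \<notin> insert a A \<longrightarrow> F i \<in> B"
      have "wedge (F(a := X)) \<in> V" if "X \<in> witt.span B" for X
        using that
      proof (induction rule: witt.span_induct_alt)
        case base
        have "wedge (F(a := 0)) = 0"
          using wedge_scale[of F a 0 0] by simp
        then show ?case
          using ext.subspace_0[OF V] by (simp only:)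
      next
        case (step c x y)
        have "wedge (F(a := x)) \<in> V"
          using insert.IH F step(1) \<open>a \<notin> A\<close> by auto
        then show ?case
          unfolding wedge_add wedge_scale
          using V step(2) by (intro ext.subspace_add ext.subspace_scale)
      qed
      from this[of "F a"] F(1) show "wedge F \<in> V"
        by simp
    qed
  qed
  from this[of UNIV] F show ?thesis
    by simp
qed

text \<open>By multilinearity the entries may be taken to be monomials times partial derivatives. If
  all monomials are \<open>1\<close>, the wedge is zero or the standard one up to sign; otherwise
  its total degree exceeds -n. This is the existence half of the description of
  \<open>Delta0\<close>.\<close>

lemma wedge_mod_higher:
  fixes F :: "'n::finite \<Rightarrow> ('n, 'k::field_prime_char) witt"
  shows "\<exists>c. wedge F - ext_scale c (wedge witt_partial) \<in> ext_higher"
proof -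
  define V where
    "V = {w :: ('n, 'k) witt_ext. \<exists>c. w - ext_scale c (wedge witt_partial) \<in> ext_higher}"
  have higher_add: "u + v \<in> ext_higher" if "u \<in> ext_higher" "v \<in> ext_higher"
    for u v :: "('n, 'k) witt_ext"
    using that unfolding ext_higher_def by (rule ext.span_add)
  have higher_scale: "ext_scale c u \<in> ext_higher" if "u \<in> ext_higher"
    for u :: "('n, 'k) witt_ext" and c
    using that unfolding ext_higher_def by (rule ext.span_scale)
  have higher_0: "0 \<in> (ext_higher :: ('n, 'k) witt_ext set)"
    unfolding ext_higher_def by (rule ext.span_zero)
  have V: "ext.subspace V"
    unfolding ext.subspace_def V_def
  proof (safe)
    show "\<exists>c. 0 - ext_scale c (wedge witt_partial) \<in> (ext_higher :: ('n, 'k) witt_ext set)"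
      by (rule exI[of _ 0]) (simp add: higher_0)
  next
    fix u v :: "('n, 'k) witt_ext" and c d
    assume "u - ext_scale c (wedge witt_partial) \<in> ext_higher"
      "v - ext_scale d (wedge witt_partial) \<in> ext_higher"
    from higher_add[OF this]
    show "\<exists>c. u + v - ext_scale c (wedge witt_partial) \<in> ext_higher"
      by (intro exI[of _ "c + d"]) (simp add: algebra_simps ext.scale_left_distrib)
  next
    fix u :: "('n, 'k) witt_ext" and c d
    assume "u - ext_scale d (wedge witt_partial) \<in> ext_higher"
    from higher_scale[OF this, of c]
    show "\<exists>d. ext_scale c u - ext_scale d (wedge witt_partial) \<in> ext_higher"
      by (intro exI[of _ "c * d"]) (simp add: ext.scale_right_diff_distrib)
  qed
  have "wedge F \<in> V" if "\<And>i. F i \<in> witt_monoms" for F :: "'n \<Rightarrow> ('n, 'k) witt"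
  proof -
    from that have "\<forall>i. \<exists>a j. F i = witt_mult (tp_monom a) (witt_partial j) \<and> (\<forall>k. a k \<le> CHAR('k) - 1)"
      by (auto simp: witt_monoms_def)
    then obtain a \<sigma> where F: "\<And>i. F i = witt_mult (tp_monom (a i)) (witt_partial (\<sigma> i))"
      and a: "\<And>i k. a i k \<le> CHAR('k) - 1"
      by metis
    show ?thesis
    proof (cases "\<forall>i k. a i k = 0")
      case True
      then have F: "F = witt_partial \<circ> \<sigma>"
        by (simp add: F fun_eq_iff tp_monom_def witt_mult_1_left)
      show ?thesis
      proof (cases "inj \<sigma>")
        case True
        then have "\<sigma> permutes UNIV"
          using inj_imp_permutes[of \<sigma> UNIV] by simp
        then have "wedge (witt_partial \<circ> \<sigma>) \<in> V"
        \<comment> \<open>The permutation is built from transpositions, each of which changes only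
          the sign.\<close>
        proof (induction \<sigma> rule: permutes_rev_induct[OF finite_class.finite_UNIV, consumes 1, case_names id swap])
          case id
          show ?case
            unfolding V_def by (intro CollectI exI[of _ 1]) (simp add: higher_0)
        next
          case (swap i j \<tau>)
          have "wedge (witt_partial \<circ> (\<tau> \<circ> Transposition.transpose i j)) =
              ext_scale (- 1) (wedge (witt_partial \<circ> \<tau>) :: ('n, 'k) witt_ext)"
            using swap by (subst o_assoc, subst wedge_transpose) auto
          then show ?case
            by (simp only: ext.subspace_scale[OF V swap.IH])
        qed
        then show ?thesis
          by (simp add: F)
      next
        case False
        then obtain i j where "i \<noteq> j" "\<sigma> i = \<sigma> j"
          by (auto simp: inj_def)
        then have "wedge F = 0"
          by (intro wedge_eq_0[of i j]) (simp_all add: F)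
        then show ?thesis
          using V by (simp add: ext.subspace_0)
      qed
    next
      case False
      define d where "d = (\<lambda>i. (\<Sum>k\<in>UNIV. int (a i k)) - 1)"
      have "F i \<in> witt_grade (d i)" for i
        unfolding witt_grade_def F d_def tp_monom_def
        by (intro witt.span_base) (use a in blast)
      then have "wedge F \<in> ext_grade (\<Sum>i\<in>UNIV. d i)"
        unfolding ext_grade_def by (intro ext.span_base) blast
      moreover have "(\<Sum>i\<in>UNIV. d i) > - int CARD('n)"
      proof -
        from False obtain i k where "a i k \<noteq> 0"
          by blast
        then have "(\<Sum>k\<in>UNIV. int (a i k)) > 0"
          by (intro sum_pos2[of UNIV k]) auto
        then have "(\<Sum>i\<in>UNIV. \<Sum>k\<in>UNIV. int (a i k)) > 0"
          by (rule sum_pos2[of UNIV i, rotated 2]) (auto intro: sum_nonneg)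
        then show ?thesis
          by (simp add: d_def sum_subtractf)
      qed
      ultimately have "wedge F \<in> ext_higher"
        unfolding ext_higher_def by (intro ext.span_base) blast
      then show ?thesis
        unfolding V_def by (intro CollectI exI[of _ 0]) simp
    qed
  qed
  from wedge_in_subspace_of_span[OF V this span_witt_monoms, of F] show ?thesis
    by (simp add: V_def)
qed

text \<open>The functional \<open>ext_det\<close> kills the higher part and is \<open>1\<close> on
  the standard wedge. So it forces the value of the scalar whose existence is given by
  \<open>wedge_mod_higher\<close>.\<close>

lemma Delta0_eq_det:
  fixes D :: "('n::{finite, linorder}, 'k::field_prime_char) witt"
  shows "Delta0 D = det (\<chi> i. const_row (witt_ppow D (card {..<i})))"
proof -
  let ?w = "wedge (\<lambda>i. witt_ppow D (card {..<i})) :: ('n, 'k) witt_ext"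
  have unique: "c = ext_det ?w" if "?w - ext_scale c (wedge witt_partial) \<in> ext_higher" for c
    using ext_det_higher[OF that] by (simp add: ext_det_diff ext_det_scale ext_det_partial)
  obtain c where c: "?w - ext_scale c (wedge witt_partial) \<in> ext_higher"
    using wedge_mod_higher by blast
  have "Delta0 D = c"
    unfolding Delta0_def ext_higher_def[symmetric]
    by (rule the_equality) (use c unique in auto)
  with unique[OF c] show ?thesis
    by (simp add: ext_det_wedge)
qed

lemma polyfun_Delta0:
  "(Delta0 :: ('n::{finite, linorder}, 'k::field_prime_char) witt \<Rightarrow> 'k) \<in> polyfun witt_scale"
proof -
  have entry: "(\<lambda>D. const_row (witt_ppow D m) $ j) \<in> polyfun witt_scale" for m and j :: 'n
    unfolding const_row_def vec_lambda_beta witt_ppow.rep_eq by (rule polyfun_eval0_funpow)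
  have "(\<lambda>D. det (\<chi> i. const_row (witt_ppow D (card {..<i})))) \<in>
      polyfun (witt_scale :: 'k \<Rightarrow> ('n, 'k) witt \<Rightarrow> _)"
    unfolding det_def vec_lambda_beta
    by (intro polyfun_sum polyfun.mult polyfun.const polyfun_prod entry)
  moreover have "Delta0 = (\<lambda>D :: ('n, 'k) witt. det (\<chi> i. const_row (witt_ppow D (card {..<i}))))"
    by (simp add: fun_eq_iff Delta0_eq_det)
  ultimately show ?thesis
    by simp
qed

section \<open>The Moore determinant\<close>

lemma polyfun_translate:
  assumes "f \<in> polyfun sc"
  shows "(\<lambda>x. f (x + a)) \<in> polyfun sc"
  using assms
proof induction
  case (linear f)
  interpret f: Vector_Spaces.linear sc "(*)" f
    by fact
  have "(\<lambda>x. f x + f a) \<in> polyfun sc"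
    by (intro polyfun.add polyfun.const polyfun.linear linear)
  then show ?case
    by (simp add: f.add)
qed (auto intro: polyfun.intros)

text \<open>The product of \<open>f - g\<close> and \<open>h\<close> vanishes everywhere while
  \<open>h\<close> is not zero. Identities therefore need checking only on the Zariski dense set
  where \<open>h\<close> is nonzero.\<close>

lemma polyfun_cong_of_dense:
  fixes f g :: "'v::ab_group_add \<Rightarrow> 'k::field"
  assumes "vector_space sc" "infinite (UNIV :: 'k set)"
    and "f \<in> polyfun sc" "g \<in> polyfun sc" "h \<in> polyfun sc" "h z \<noteq> 0"
    and "\<And>x. h x \<noteq> 0 \<Longrightarrow> f x = g x"
  shows "f x = g x"
proof -
  have "(\<forall>x. f x - g x = 0) \<or> (\<forall>x. h x = 0)"
    using assms by (intro polyfun_domain[OF assms(1,2)] polyfun_diff) auto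
  with assms(6) show ?thesis
    by auto
qed

lemma prime_CHAR: "Factorial_Ring.prime CHAR('k::field_prime_char)"
  by (rule prime_CHAR_semidom) (simp add: CHAR_pos)

lemma inj_card_lessThan: "inj (\<lambda>i :: 'n::{finite, linorder}. card {..<i})"
proof (rule linorder_injI)
  fix i j :: 'n
  assume "i < j"
  then have "{..<i} \<subset> {..<j}"
    by auto
  then show "card {..<i} \<noteq> card {..<j}"
    using psubset_card_mono[of "{..<j}" "{..<i}"] by simp
qed

lemma card_lessThan_less: "card {..<i} < CARD('n)" for i :: "'n::{finite, linorder}"
  by (intro psubset_card_mono) auto

text \<open>The rows are indexed by the coordinates of \<open>l\<close>, so that row operations act on \<open>l\<close>.\<close>

definition moore :: "'k::field_prime_char ^ 'n::{finite, linorder} \<Rightarrow> 'k" where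
  "moore l = det (\<chi> j r. (l $ j) ^ (CHAR('k) ^ card {..<r}))"

lemma linear_vec_nth: "Vector_Spaces.linear (*s) (*) (\<lambda>l :: 'k::field ^ 'n. l $ j)"
  by (simp add: Vector_Spaces.linear_iff vec.vector_space_axioms vector_space_field)

lemma polyfun_power: "f \<in> polyfun sc \<Longrightarrow> (\<lambda>x. f x ^ m) \<in> polyfun sc"
  by (induction m) (auto intro: polyfun.intros)

lemma polyfun_moore: "moore \<in> polyfun (*s)"
  unfolding moore_def det_def vec_lambda_beta
  by (intro polyfun_sum polyfun.mult polyfun.const polyfun_prod polyfun_power polyfun.linear
      linear_vec_nth)

lemma moore_eq_0:
  fixes l :: "'k::field_prime_char ^ 'n::{finite, linorder}"
  assumes "l $ i = 0"
  shows "moore l = 0"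
  unfolding moore_def using assms CHAR_pos[where ?'a = 'k]
  by (intro det_zero_row(2)[of i]) (simp add: row_def vec_eq_iff power_0_left)

text \<open>At \<open>l\<^sub>j = \<theta>\<^sup>j\<close> the matrix is the Vandermonde matrix of the Frobenius conjugates of \<open>\<theta>\<close>.\<close>

lemma moore_nonzero:
  assumes inf: "infinite (UNIV :: 'k::field_prime_char set)"
  obtains l :: "'k::field_prime_char ^ 'n::{finite, linorder}" where "moore l \<noteq> 0"
proof -
  let ?p = "CHAR('k)"
  have p1: "?p > 1"
    using prime_CHAR[where ?'k = 'k] by (rule prime_gt_1_nat)
  \<comment> \<open>The roots of \<open>Q (a, b)\<close> are the elements with coinciding conjugates
    of index \<open>a\<close> and \<open>b\<close>; an infinite field has an element avoiding all
    these finite root sets.\<close>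
  define Q where "Q = (\<lambda>(a, b). Polynomial.monom 1 (?p ^ a) - Polynomial.monom (1 :: 'k) (?p ^ b))"
  define I where "I = {(a, b). a < CARD('n) \<and> b < CARD('n) \<and> a \<noteq> b}"
  have "finite I"
    by (rule finite_subset[of _ "{..<CARD('n)} \<times> {..<CARD('n)}"]) (auto simp: I_def)
  moreover have "finite {x. poly (Q ab) x = 0}" if I: "ab \<in> I" for ab
  proof -
    obtain a b where ab: "ab = (a, b)" "a \<noteq> b"
      using I unfolding I_def by blast
    then have "?p ^ a \<noteq> ?p ^ b"
      using p1 by (simp add: power_inject_exp)
    then have "Polynomial.coeff (Q ab) (?p ^ a) = 1"
      by (simp add: Q_def ab)
    then have "Q ab \<noteq> 0"
      by auto
    then show ?thesis
      by (rule poly_roots_finite)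
  qed
  ultimately have "finite (\<Union>ab\<in>I. {x. poly (Q ab) x = 0})"
    by blast
  then obtain \<theta> where \<theta>: "\<theta> \<notin> (\<Union>ab\<in>I. {x. poly (Q ab) x = 0})"
    using inf ex_new_if_finite by blast
  have conj: "\<theta> ^ (?p ^ a) \<noteq> \<theta> ^ (?p ^ b)" if "a < CARD('n)" "b < CARD('n)" "a \<noteq> b" for a b
    using \<theta> that by (auto simp: Q_def I_def poly_monom)
  define r where "r = (\<lambda>j :: 'n. card {..<j})"
  have r_less: "r j < CARD('n)" for j
    unfolding r_def by (rule card_lessThan_less)
  have r_le: "r j \<le> CARD('n) - 1" for j
    using r_less[of j] by linarith
  define M :: "(('k, 'n) vec, 'n) vec" where "M = (\<chi> j i. (\<theta> ^ r j) ^ (?p ^ r i))"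
  \<comment> \<open>A kernel vector is the coefficient vector of a polynomial of degree less than n
    that vanishes at the n distinct conjugates of \<open>\<theta>\<close>.\<close>
  have "x = 0" if x: "transpose M *v x = 0" for x
  proof (rule ccontr)
    assume "x \<noteq> 0"
    then obtain j where j: "x $ j \<noteq> 0"
      by (auto simp: vec_eq_iff)
    define P where "P = (\<Sum>j\<in>UNIV. Polynomial.monom (x $ j) (r j))"
    have "Polynomial.coeff P (r j) = (\<Sum>i\<in>UNIV. if i = j then x $ i else 0)"
      unfolding P_def coeff_sum
      using inj_card_lessThan[where ?'n = 'n] by (intro sum.cong) (auto simp: r_def inj_def)
    then have "P \<noteq> 0"
      using j by auto
    have deg: "degree P \<le> CARD('n) - 1"
      unfolding P_def by (intro degree_sum_le order.trans[OF degree_monom_le] r_le) simp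
    have "poly P (\<theta> ^ (?p ^ r i)) = 0" for i
    proof -
      have "poly P (\<theta> ^ (?p ^ r i)) = (transpose M *v x) $ i"
        by (simp add: P_def poly_sum poly_monom M_def matrix_vector_mult_def transpose_def
            mult.commute flip: power_mult)
      then show ?thesis
        by (simp only: x zero_index)
    qed
    then have "(\<lambda>i. \<theta> ^ (?p ^ r i)) ` UNIV \<subseteq> {x. poly P x = 0}"
      by auto
    then have "card (range (\<lambda>i. \<theta> ^ (?p ^ r i))) \<le> card {x. poly P x = 0}"
      by (intro card_mono poly_roots_finite \<open>P \<noteq> 0\<close>)
    moreover have "inj (\<lambda>i. \<theta> ^ (?p ^ r i))"
      using conj r_less inj_card_lessThan[where ?'n = 'n]
      unfolding inj_def r_def by metis
    ultimately have "CARD('n) \<le> degree P"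
      using card_poly_roots_bound[OF \<open>P \<noteq> 0\<close>] by (simp add: card_image)
    moreover have "CARD('n) > 0"
      by simp
    ultimately show False
      using deg by linarith
  qed
  then have "invertible (transpose M)"
    by (auto simp: invertible_left_inverse matrix_left_invertible_ker)
  then have "det M \<noteq> 0"
    by (simp add: invertible_det_nz)
  then show ?thesis
    using that[of "\<chi> j. \<theta> ^ r j"] by (simp add: moore_def M_def r_def)
qed

lemma of_nat_power_CHAR_power:
  "(of_nat c :: 'k::field_prime_char) ^ (CHAR('k) ^ m) = of_nat c"
  using CHAR_pos[where ?'a = 'k]
  by (induction c) (simp_all add: power_0_left freshmans_dream'[OF prime_CHAR refl])

text \<open>Frobenius fixes the prime field, so a linear relation over it among the coordinates
  passes to all their Frobenius powers. The difference of the two coefficient vectors is then a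
  nonzero kernel vector of the transposed Moore matrix.\<close>

lemma moore_eq_0_of_dependent:
  fixes l :: "'k::field_prime_char ^ 'n::{finite, linorder}"
  assumes "(\<Sum>j\<in>UNIV. of_nat (c j) * l $ j) = (\<Sum>j\<in>UNIV. of_nat (d j) * l $ j)"
    and "(of_nat (c i) :: 'k) \<noteq> of_nat (d i)"
  shows "moore l = 0"
proof -
  define M :: "(('k, 'n) vec, 'n) vec" where "M = (\<chi> j r. (l $ j) ^ (CHAR('k) ^ card {..<r}))"
  define x :: "('k, 'n) vec" where "x = (\<chi> j. of_nat (c j) - of_nat (d j))"
  have frob: "(\<Sum>j\<in>UNIV. of_nat (e j) * (l $ j) ^ (CHAR('k) ^ m)) =
      (\<Sum>j\<in>UNIV. of_nat (e j) * l $ j) ^ (CHAR('k) ^ m)" for e :: "'n \<Rightarrow> nat" and m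
    by (simp add: freshmans_dream_sum'[OF prime_CHAR refl] power_mult_distrib of_nat_power_CHAR_power)
  have "(transpose M *v x) $ r = 0" for r
  proof -
    let ?m = "card {..<r}"
    have "(transpose M *v x) $ r = (\<Sum>j\<in>UNIV. of_nat (c j) * (l $ j) ^ (CHAR('k) ^ ?m)) -
        (\<Sum>j\<in>UNIV. of_nat (d j) * (l $ j) ^ (CHAR('k) ^ ?m))"
      by (simp add: M_def x_def matrix_vector_mult_def transpose_def algebra_simps sum_subtractf)
    then show ?thesis
      by (simp add: frob assms(1))
  qed
  then have "transpose M *v x = 0"
    by (simp add: vec_eq_iff)
  moreover have "x $ i \<noteq> 0"
    using assms(2) by (simp add: x_def)
  then have "x \<noteq> 0"
    by auto
  ultimately have "\<not> invertible (transpose M)"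
    by (auto simp: invertible_left_inverse matrix_left_invertible_ker)
  then show ?thesis
    by (simp add: invertible_det_nz moore_def M_def)
qed

text \<open>Setting coordinate \<open>i\<close> to \<open>s\<close> changes row \<open>i\<close>
  only, and expanding along that row gives a combination of the powers of \<open>s\<close> with
  exponents 1, p, ..., p^(n-1).\<close>

lemma moore_poly:
  fixes l :: "'k::field_prime_char ^ 'n::{finite, linorder}"
  obtains q where "degree q \<le> CHAR('k) ^ (CARD('n) - 1)"
    and "\<And>s. moore (l + (s - l $ i) *s axis i 1) = poly q s"
proof -
  let ?e = "\<lambda>r :: 'n. CHAR('k) ^ card {..<r}"
  \<comment> \<open>The coefficients are cofactors: determinants with row \<open>i\<close> replaced
    by a unit vector.\<close>
  define q where "q = (\<Sum>r\<in>UNIV. Polynomial.monom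
     (det (\<chi> j. if j = i then axis r 1 else (\<chi> r. (l $ j) ^ ?e r))) (?e r))"
  have "?e r \<le> CHAR('k) ^ (CARD('n) - 1)" for r
    using card_lessThan_less[of r] CHAR_pos[where ?'a = 'k] by (intro power_increasing) (auto simp: Suc_le_eq)
  then have "degree q \<le> CHAR('k) ^ (CARD('n) - 1)"
    unfolding q_def by (intro degree_sum_le order.trans[OF degree_monom_le]) auto
  moreover have "moore (l + (s - l $ i) *s axis i 1) = poly q s" for s
  proof -
    let ?c = "\<lambda>j. \<chi> r. (l $ j) ^ ?e r"
    have "moore (l + (s - l $ i) *s axis i 1) =
        det (\<chi> j. if j = i then (\<Sum>r\<in>UNIV. s ^ ?e r *s axis r 1) else ?c j)"
      unfolding moore_def
      by (intro arg_cong[of _ _ det]) (auto simp: vec_eq_iff axis_def if_distrib cong: if_cong)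
    also have "\<dots> = (\<Sum>r\<in>UNIV. det (\<chi> j. if j = i then s ^ ?e r *s axis r 1 else ?c j))"
      by (rule det_linear_row_sum) simp
    also have "\<dots> = poly q s"
      unfolding q_def poly_sum poly_monom by (simp add: det_row_mul mult.commute)
    finally show ?thesis .
  qed
  ultimately show ?thesis
    using that by blast
qed

section \<open>Invariance under transvections over the prime field\<close>

definition transvect_invariant :: "('k::field ^ 'n \<Rightarrow> 'k) \<Rightarrow> bool" where
  "transvect_invariant f \<longleftrightarrow> (\<forall>i j l. i \<noteq> j \<longrightarrow> f (l - (l $ j) *s axis i 1) = f l)"

lemma transvect_invariant_of_nat:
  fixes l :: "'k::field ^ 'n"
  assumes f: "transvect_invariant f" and "i \<noteq> j"
  shows "f (l - (of_nat c * l $ j) *s axis i 1) = f l"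
proof (induction c)
  case (Suc c)
  let ?l = "l - (of_nat c * l $ j) *s axis i 1"
  have j: "?l $ j = l $ j"
    using \<open>i \<noteq> j\<close> by (simp add: axis_def)
  have "l - (of_nat (Suc c) * l $ j) *s axis i 1 = ?l - (?l $ j) *s axis i 1"
    unfolding j by (simp add: vec_eq_iff algebra_simps)
  also have "f \<dots> = f ?l"
    using f \<open>i \<noteq> j\<close> unfolding transvect_invariant_def by blast
  finally show ?case
    using Suc by simp
qed simp

lemma transvect_invariant_sum:
  fixes l :: "'k::field ^ 'n"
  assumes f: "transvect_invariant f" and "i \<notin> A"
  shows "f (l - (\<Sum>j\<in>A. of_nat (c j) * l $ j) *s axis i 1) = f l"
proof -
  have "finite A"
    by simp
  then show ?thesis
    using \<open>i \<notin> A\<close>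
  proof (induction A)
    case (insert j A)
    let ?l = "l - (\<Sum>j\<in>A. of_nat (c j) * l $ j) *s axis i 1"
    have j: "?l $ j = l $ j"
      using insert by (auto simp: axis_def)
    have "l - (\<Sum>j\<in>insert j A. of_nat (c j) * l $ j) *s axis i 1 =
        ?l - (of_nat (c j) * ?l $ j) *s axis i 1"
      unfolding j using insert by (simp add: vec_eq_iff algebra_simps)
    also have "f \<dots> = f ?l"
      using insert by (intro transvect_invariant_of_nat f) auto
    also have "\<dots> = f l"
      using insert by simp
    finally show ?case .
  qed simp
qed

lemma card_coefficients:
  "card ((UNIV - {i}) \<rightarrow>\<^sub>E {..<m}) = m ^ (CARD('n) - 1)" for i :: "'n::finite"
  by (simp add: card_PiE card_Diff_singleton)

lemma of_nat_eq_iff_less_CHAR: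
  assumes "a < CHAR('k::field_prime_char)" "b < CHAR('k)" "(of_nat a :: 'k) = of_nat b"
  shows "a = b"
  using assms by (simp add: of_nat_eq_iff_cong_CHAR cong_def)

text \<open>
  If \<open>G\<close> vanishes for \<open>l\<^sub>i = 0\<close>, then by invariance it vanishes whenever \<open>l\<^sub>i\<close> is a combination of
  the other coordinates over the prime field. For fixed other coordinates these are as many roots
  as the degree of \<open>moore\<close> in \<open>l\<^sub>i\<close>, which leaves degree \<open>0\<close> for \<open>H\<close>.
\<close>

lemma moore_cofactor_constant_direction:
  fixes G H :: "'k::field_prime_char ^ 'n::{finite, linorder} \<Rightarrow> 'k"
  assumes inf: "infinite (UNIV :: 'k set)"
    and G: "G \<in> polyfun (*s)" and H: "H \<in> polyfun (*s)" and GH: "\<And>l. G l * H l = moore l"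
    and inv: "transvect_invariant G" and zero: "\<And>l. l $ i = 0 \<Longrightarrow> G l = 0"
  shows "H (l + s *s axis i 1) = H l"
proof -
  \<comment> \<open>Where \<open>moore l\<close> is nonzero, the coordinates are independent over
    the prime field and the restriction \<open>q\<close> is not zero; density handles the other
    \<open>l\<close>.\<close>
  have generic: "H (l + s *s axis i 1) = H l" if "moore l \<noteq> 0" for l s
  proof -
    let ?L = "\<lambda>s. l + (s - l $ i) *s axis i 1"
    have line: "?L s = (l - (l $ i) *s axis i 1) + s *s axis i 1" for s
      by (simp add: vec_eq_iff algebra_simps)
    obtain q where q: "degree q \<le> CHAR('k) ^ (CARD('n) - 1)" "\<And>s. moore (?L s) = poly q s"
      using moore_poly[where l = l and i = i] by blast
    obtain g where g: "\<And>s. G (?L s) = poly g s"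
      unfolding line
      using polyfun_on_line[OF vec.vector_space_axioms G, where x = "l - (l $ i) *s axis i 1" and y = "axis i 1"]
      by blast
    obtain h where h: "\<And>s. H (?L s) = poly h s"
      unfolding line
      using polyfun_on_line[OF vec.vector_space_axioms H, where x = "l - (l $ i) *s axis i 1" and y = "axis i 1"]
      by blast
    have "poly (g * h - q) s = 0" for s
      by (simp add: GH flip: g h q(2))
    then have gh: "g * h = q"
      using infinite_poly_vanish[OF inf] by (metis eq_iff_diff_eq_0)
    have "poly q (l $ i) = moore l"
      using q(2)[of "l $ i"] by simp
    with that have "q \<noteq> 0"
      by auto
    then have gh0: "g \<noteq> 0" "h \<noteq> 0"
      using gh by auto
    \<comment> \<open>Coefficient vectors over the prime field, represented by naturals below p;
      \<open>?s c\<close> is the corresponding combination of the other coordinates.\<close>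
    let ?C = "(UNIV - {i}) \<rightarrow>\<^sub>E {..<CHAR('k)}"
    let ?s = "\<lambda>c. \<Sum>j\<in>UNIV - {i}. of_nat (c j) * l $ j"
    have "poly g (?s c) = 0" for c
    proof -
      have others: "?L (?s c) $ j = l $ j" if "j \<noteq> i" for j
        using that by (simp add: axis_def)
      have "(\<Sum>j\<in>UNIV - {i}. of_nat (c j) * ?L (?s c) $ j) = ?s c"
      proof (intro sum.cong refl)
        fix j
        assume "j \<in> UNIV - {i}"
        then have "j \<noteq> i"
          by simp
        then show "of_nat (c j) * ?L (?s c) $ j = of_nat (c j) * l $ j"
          by (simp only: others not_False_eq_True)
      qed
      then have "poly g (?s c) = G (?L (?s c) - ?s c *s axis i 1)"
        using transvect_invariant_sum[OF inv, of i "UNIV - {i}" "?L (?s c)" c] by (simp add: g)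
      also have "\<dots> = 0"
        by (intro zero) (simp add: axis_def)
      finally show ?thesis .
    qed
    then have "?s ` ?C \<subseteq> {x. poly g x = 0}"
      by blast
    then have "card (?s ` ?C) \<le> card {x. poly g x = 0}"
      by (intro card_mono poly_roots_finite gh0)
    also have "\<dots> \<le> degree g"
      by (intro card_poly_roots_bound gh0)
    also have "inj_on ?s ?C"
    proof (rule inj_onI, rule ccontr)
      fix c d
      assume c: "c \<in> ?C" and d: "d \<in> ?C" and eq: "?s c = ?s d" and "c \<noteq> d"
      then obtain j where j: "j \<noteq> i" "c j \<noteq> d j"
        using PiE_ext[OF c d] by blast
      \<comment> \<open>Members of \<open>?C\<close> have the default value \<open>undefined\<close>
        at \<open>i\<close>, so the coefficient there is set to \<open>0\<close> before summing over
        all coordinates.\<close>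
      have extend: "(\<Sum>j\<in>UNIV. of_nat ((e(i := 0)) j) * l $ j) = ?s e" for e :: "'n \<Rightarrow> nat"
        by (subst sum.remove[of _ i]) (auto intro!: sum.cong)
      have "c j < CHAR('k)" "d j < CHAR('k)"
        using c d j(1) by (auto simp: PiE_iff)
      then have "(of_nat (c j) :: 'k) \<noteq> of_nat (d j)"
        using j(2) of_nat_eq_iff_less_CHAR by blast
      then have "(of_nat ((c(i := 0)) j) :: 'k) \<noteq> of_nat ((d(i := 0)) j)"
        using j(1) by simp
      then have "moore l = 0"
        by (rule moore_eq_0_of_dependent[rotated]) (simp only: extend eq)
      with that show False
        by simp
    qed
    then have "card (?s ` ?C) = CHAR('k) ^ (CARD('n) - 1)"
      by (simp add: card_image card_coefficients)
    finally have "degree q \<le> degree g"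
      using q(1) by linarith
    then have "degree h = 0"
      using degree_mult_eq[OF gh0] gh by simp
    then obtain a where a: "h = [:a:]"
      by (rule degree_eq_zeroE)
    have "H l = a"
      using h[of "l $ i"] by (simp add: a)
    moreover have "H (l + s *s axis i 1) = a"
      using h[of "l $ i + s"] by (simp add: a)
    ultimately show ?thesis
      by simp
  qed
  obtain z :: "('k, 'n) vec" where "moore z \<noteq> 0"
    using moore_nonzero[OF inf] by blast
  then show ?thesis
    by (rule polyfun_cong_of_dense[OF vec.vector_space_axioms inf polyfun_translate[OF H] H
          polyfun_moore, of z]) (auto intro: generic)
qed

text \<open>Invariance carries the zeros of \<open>G\<close> from one coordinate hyperplane to all
  of them. Thus \<open>H\<close> is constant in every coordinate direction, and every point is
  reached from \<open>0\<close> along these.\<close>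

lemma moore_cofactor_constant:
  fixes G H :: "'k::field_prime_char ^ 'n::{finite, linorder} \<Rightarrow> 'k"
  assumes inf: "infinite (UNIV :: 'k set)"
    and G: "G \<in> polyfun (*s)" and H: "H \<in> polyfun (*s)" and GH: "\<And>l. G l * H l = moore l"
    and inv: "transvect_invariant G" and zero: "\<And>l. l $ i = 0 \<Longrightarrow> G l = 0"
  shows "H l = H 0"
proof -
  have zero_all: "G l = 0" if l: "l $ j = 0" for l j
  proof (cases "j = i")
    case False
    \<comment> \<open>Move the zero from coordinate \<open>j\<close> to coordinate \<open>i\<close> by two shears.\<close>
    let ?m = "l - (l $ i) *s axis j 1"
    \<comment> \<open>Invariance is at hand for subtracting natural multiples; p - 1 serves as
      \<open>-1\<close> and turns subtraction into addition.\<close>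
    obtain c where "CHAR('k) = Suc c"
      using CHAR_pos[where ?'a = 'k] gr0_implies_Suc by blast
    then have "of_nat (Suc c) = (0 :: 'k)"
      by (metis of_nat_CHAR)
    then have c: "(of_nat c :: 'k) = - 1"
      unfolding of_nat_Suc by (metis eq_neg_iff_add_eq_0 add.commute)
    have "G l = G ?m"
      using inv False by (simp add: transvect_invariant_def)
    also have "\<dots> = G (?m - (of_nat c * ?m $ j) *s axis i 1)"
      using transvect_invariant_of_nat[OF inv, of i j ?m c] False by auto
    also have "\<dots> = 0"
      using False l by (intro zero) (simp add: c axis_def)
    finally show ?thesis .
  qed (use zero l in simp)
  have "H (\<Sum>j\<in>A. (l $ j) *s axis j 1) = H 0" for A
  proof (induction A rule: infinite_finite_induct)
    case (insert j A)
    have "H ((\<Sum>j\<in>A. (l $ j) *s axis j 1) + (l $ j) *s axis j 1) = H (\<Sum>j\<in>A. (l $ j) *s axis j 1)"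
      by (rule moore_cofactor_constant_direction[OF inf G H GH inv zero_all])
    then show ?case
      using insert by (simp add: add.commute)
  qed simp_all
  from this[of UNIV] show ?thesis
    by (simp add: basis_expansion)
qed

lemma moore_factor_constant:
  fixes G H :: "'k::field_prime_char ^ 'n::{finite, linorder} \<Rightarrow> 'k"
  assumes inf: "infinite (UNIV :: 'k set)"
    and G: "G \<in> polyfun (*s)" and H: "H \<in> polyfun (*s)" and GH: "\<And>l. G l * H l = moore l"
    and inv: "\<And>i j l. i \<noteq> j \<Longrightarrow> moore l \<noteq> 0 \<Longrightarrow>
      G (l - (l $ j) *s axis i 1) = G l \<and> H (l - (l $ j) *s axis i 1) = H l"
  shows "(\<forall>l. G l = G 0) \<or> (\<forall>l. H l = H 0)"
proof -
  obtain z :: "('k, 'n) vec" where z: "moore z \<noteq> 0"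
    using moore_nonzero[OF inf] by blast
  have shear: "Vector_Spaces.linear (*s) (*s) (\<lambda>l :: ('k, 'n) vec. l - (l $ j) *s axis i 1)" for i j
    by (simp add: Vector_Spaces.linear_iff vec.vector_space_axioms vec_eq_iff algebra_simps)
  have invariant: "transvect_invariant f"
    if f: "f \<in> polyfun (*s)"
      and "\<And>i j l. i \<noteq> j \<Longrightarrow> moore l \<noteq> 0 \<Longrightarrow> f (l - (l $ j) *s axis i 1) = f l"
    for f :: "('k, 'n) vec \<Rightarrow> 'k"
    unfolding transvect_invariant_def
  proof (intro allI impI)
    fix i j :: 'n and l :: "('k, 'n) vec"
    assume ij: "i \<noteq> j"
    show "f (l - (l $ j) *s axis i 1) = f l"
      by (rule polyfun_cong_of_dense[OF vec.vector_space_axioms inf polyfun_comp_linear[OF shear f] f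
            polyfun_moore z]) (rule that(2)[OF ij])
  qed
  have G_inv: "transvect_invariant G" and H_inv: "transvect_invariant H"
    using G H inv by (auto intro!: invariant)
  obtain i :: 'n where True
    by simp
  \<comment> \<open>The map \<open>shear\<close> with equal indices is the projection onto the
    hyperplane where coordinate \<open>i\<close> is zero. Composing with it lets
    \<open>polyfun_domain\<close> on the whole space show that one factor vanishes on that
    hyperplane.\<close>
  have "(\<forall>l. G (l - (l $ i) *s axis i 1) = 0) \<or> (\<forall>l. H (l - (l $ i) *s axis i 1) = 0)"
    by (intro polyfun_domain[OF vec.vector_space_axioms inf] polyfun_comp_linear[OF shear] G H)
      (simp add: GH moore_eq_0[of _ i] axis_def)
  moreover have "l - (l $ i) *s axis i 1 = l" if "l $ i = 0" for l :: "('k, 'n) vec"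
    using that by simp
  ultimately have "(\<forall>l. l $ i = 0 \<longrightarrow> G l = 0) \<or> (\<forall>l. l $ i = 0 \<longrightarrow> H l = 0)"
    by metis
  then show ?thesis
  proof
    assume "\<forall>l. l $ i = 0 \<longrightarrow> G l = 0"
    then show ?thesis
      using moore_cofactor_constant[OF inf G H GH G_inv, of i] by blast
  next
    assume "\<forall>l. l $ i = 0 \<longrightarrow> H l = 0"
    moreover have "H l * G l = moore l" for l
      using GH[of l] by (simp add: mult.commute)
    ultimately show ?thesis
      using moore_cofactor_constant[OF inf H G _ H_inv, of i] by blast
  qed
qed

section \<open>Curves of conjugate tori\<close>

lemma derivation_funpow_eigen:
  assumes "witt_apply D f = tp_scale c f"
  shows "(witt_apply D ^^ m) f = tp_scale (c ^ m) f"
  by (induction m) (simp_all add: assms witt_apply_scale_right mult.commute)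

lemma witt_apply_1_plus: "witt_apply D (1 + f) = witt_apply D f"
  by (simp add: witt_apply_add_right witt_apply_1)

text \<open>Powers of \<open>D\<close> multiply the eigenvector by powers of \<open>c\<close>, and
  the eigenvector has value \<open>1\<close> at the origin.\<close>

lemma const_row_ppow_eigen:
  fixes D :: "('n::finite, 'k::field_prime_char) witt"
  assumes "witt_apply D (1 + tp_var j) = tp_scale c (1 + tp_var j)"
  shows "const_row (witt_ppow D m) $ j = c ^ (CHAR('k) ^ m)"
proof -
  have "witt_apply (witt_ppow D m) (tp_var j) = tp_scale (c ^ (CHAR('k) ^ m)) (1 + tp_var j)"
    using derivation_funpow_eigen[OF assms] witt_apply_1_plus[of "witt_ppow D m" "tp_var j"]
    by (simp add: witt_ppow.rep_eq)
  then show ?thesis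
    by (simp add: const_row_def tp_eval0_scale tp_eval0_add tp_eval0_1 tp_eval0_var)
qed

lemma Delta0_eq_det_transpose:
  fixes D :: "('n::{finite, linorder}, 'k::field_prime_char) witt"
  shows "Delta0 D = det (\<chi> j r. const_row (witt_ppow D (card {..<r})) $ j)"
proof -
  have "(\<chi> j r. const_row (witt_ppow D (card {..<r})) $ j) =
      transpose (\<chi> i. const_row (witt_ppow D (card {..<i})))"
    by (simp add: transpose_def)
  from arg_cong[OF this, of det] show ?thesis
    by (simp only: Delta0_eq_det det_transpose)
qed

text \<open>The shift by \<open>1\<close> matters: the eigenvectors 1 + x_j are units, whereas on
  the torus spanned by the x_j times the partial derivatives all constant rows, and hence
  \<open>Delta0\<close>, vanish.\<close>

definition toral :: "'k::field_prime_char ^ 'n::finite \<Rightarrow> ('n, 'k) witt" where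
  "toral l = (\<Sum>j\<in>UNIV. witt_scale (l $ j) (witt_mult (1 + tp_var j) (witt_partial j)))"

lemma linear_toral: "Vector_Spaces.linear (*s) witt_scale toral"
  by (simp add: Vector_Spaces.linear_iff vec.vector_space_axioms witt.vector_space_axioms
      toral_def witt.scale_left_distrib sum.distrib witt.scale_sum_right)

lemma toral_var: "witt_apply (toral l) (tp_var j) = tp_scale (l $ j) (1 + tp_var j)"
proof -
  have "witt_apply (toral l) (tp_var j) =
      (\<Sum>i\<in>UNIV. if i = j then tp_scale (l $ j) (1 + tp_var j) else 0)"
    unfolding toral_def witt_apply_sum_left
    by (intro sum.cong) (auto simp: witt_scale.rep_eq witt_mult.rep_eq witt_partial_var)
  then show ?thesis
    by simp
qed

lemma Delta0_toral:
  fixes l :: "'k::field_prime_char ^ 'n::{finite, linorder}"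
  shows "Delta0 (toral l) = moore l"
proof -
  have "const_row (witt_ppow (toral l) m) $ j = (l $ j) ^ (CHAR('k) ^ m)" for m j
    by (rule const_row_ppow_eigen) (simp add: witt_apply_1_plus toral_var)
  then show ?thesis
    by (simp add: Delta0_eq_det_transpose moore_def)
qed

definition shear_term :: "'n \<Rightarrow> 'n \<Rightarrow> nat \<Rightarrow> ('n::finite, 'k::field_prime_char) witt" where
  "shear_term i j m = witt_mult ((- tp_var j) ^ m * (1 + tp_var j) * (1 + tp_var i)) (witt_partial i)"

text \<open>
  Diagonal with eigenvalues \<open>l\<close> after replacing \<open>1 + x\<^sub>i\<close> by \<open>(1 + x\<^sub>i) (1 + t x\<^sub>j)\<close>; the powers
  of \<open>- t x\<^sub>j\<close> sum up to the inverse of \<open>1 + t x\<^sub>j\<close>.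
\<close>

definition sheared_toral ::
    "'k::field_prime_char ^ 'n::finite \<Rightarrow> 'n \<Rightarrow> 'n \<Rightarrow> 'k \<Rightarrow> ('n, 'k) witt" where
  "sheared_toral l i j t =
     toral l - witt_scale (l $ j) (\<Sum>m<CHAR('k). witt_scale (t ^ Suc m) (shear_term i j m))"

text \<open>The variable is nilpotent of exponent at most p, so the truncated geometric series is an
  exact inverse.\<close>

lemma one_plus_var_geometric:
  "(1 + tp_scale t (tp_var j)) * (\<Sum>m<CHAR('k). tp_scale (t ^ m) ((- tp_var j) ^ m)) =
     (1 :: ('n, 'k::field_prime_char) trunc_poly)"
proof -
  let ?u = "tp_scale (- t) (tp_var j) :: ('n, 'k) trunc_poly"
  have power: "tp_scale a f ^ m = tp_scale (a ^ m) (f ^ m)" for a m and f :: "('n, 'k) trunc_poly"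
    by (induction m) (simp_all add: tp_scale_mult_left tp_scale_mult_right)
  have u: "?u ^ m = tp_scale (t ^ m) ((- tp_var j) ^ m)" for m
    using power[of t "- tp_var j" m] by simp
  have "?u ^ CHAR('k) = 0"
    unfolding power tp_var_power_CHAR by simp
  then have "(1 - ?u) * (\<Sum>m<CHAR('k). ?u ^ m) = 1"
    using one_diff_power_eq[of ?u "CHAR('k)"] by (simp only: diff_zero)
  moreover have "1 - ?u = 1 + tp_scale t (tp_var j)"
    by simp
  ultimately show ?thesis
    by (simp only: u)
qed

lemma sheared_toral_var:
  "witt_apply (sheared_toral l i j t) (tp_var k) =
     (if k = i then tp_scale (l $ i) (1 + tp_var i) - tp_scale (l $ j * t)
        ((\<Sum>m<CHAR('k). tp_scale (t ^ m) ((- tp_var j) ^ m)) * (1 + tp_var j) * (1 + tp_var i))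
      else tp_scale (l $ k) (1 + tp_var k :: ('n::finite, 'k::field_prime_char) trunc_poly))"
proof -
  have "witt_apply (shear_term i j m) (tp_var k) =
      (if k = i then (- tp_var j) ^ m * (1 + tp_var j) * (1 + tp_var i)
       else 0 :: ('n, 'k) trunc_poly)" for m
    by (simp add: shear_term_def witt_mult.rep_eq witt_partial_var)
  then show ?thesis
    by (simp add: sheared_toral_def minus_witt.rep_eq witt_scale.rep_eq witt_apply_sum_left toral_var
        sum_distrib_right sum_distrib_left tp_scale_mult_left tp_scale_mult_right tp.scale_sum_right mult_ac)
qed

lemma sheared_toral_0: "sheared_toral l i j 0 = toral l"
  by (simp add: sheared_toral_def)

text \<open>At t = 1 the inverse of 1 + t x_j cancels the factor 1 + x_j in
  \<open>shear_term\<close>, so the curve returns to the torus, at a transvected point.\<close>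

lemma sheared_toral_1:
  fixes l :: "'k::field_prime_char ^ 'n::finite"
  assumes "i \<noteq> j"
  shows "sheared_toral l i j 1 = toral (l - (l $ j) *s axis i 1)"
proof (rule witt_eqI)
  fix k
  have "(\<Sum>m<CHAR('k). (- tp_var j) ^ m) * (1 + tp_var j) = (1 :: ('n, 'k) trunc_poly)"
    using one_plus_var_geometric[of 1 j] by (simp add: mult.commute)
  then show "witt_apply (sheared_toral l i j 1) (tp_var k) =
      witt_apply (toral (l - (l $ j) *s axis i 1)) (tp_var k)"
    by (simp add: sheared_toral_var toral_var axis_def tp.scale_left_diff_distrib)
qed

text \<open>The derivation has eigenvectors 1 + x_k for k other than \<open>i\<close>, and (1 +
  x_i)(1 + t x_j), with eigenvalues \<open>l\<close>. Its constant rows differ from the Moore matrix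
  by subtracting \<open>t\<close> times row \<open>j\<close> from row \<open>i\<close>, which
  preserves the determinant.\<close>

lemma Delta0_sheared_toral:
  fixes l :: "'k::field_prime_char ^ 'n::{finite, linorder}"
  assumes "i \<noteq> j"
  shows "Delta0 (sheared_toral l i j t) = moore l"
proof -
  let ?D = "sheared_toral l i j t"
  let ?X = "\<lambda>k. 1 + tp_var k :: ('n, 'k) trunc_poly"
  let ?u = "1 + tp_scale t (tp_var j) :: ('n, 'k) trunc_poly"
  let ?s = "\<Sum>m<CHAR('k). tp_scale (t ^ m) ((- tp_var j) ^ m) :: ('n, 'k) trunc_poly"
  have eigen: "witt_apply ?D (?X k) = tp_scale (l $ k) (?X k)" if "k \<noteq> i" for k
    using that by (simp add: witt_apply_1_plus sheared_toral_var)
  \<comment> \<open>The first summand comes from differentiating 1 + x_i, the second from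
    differentiating 1 + t x_j; the terms with \<open>b * t\<close> cancel once \<open>u * s\<close>
    is \<open>1\<close>.\<close>
  have expand: "(tp_scale a X - tp_scale (b * t) (s * Y * X)) * u + X * tp_scale t (tp_scale b Y) =
      tp_scale a (X * u) - tp_scale (b * t) ((u * s) * (Y * X)) + tp_scale (b * t) (Y * X)"
    for a b and X Y u s :: "('n, 'k) trunc_poly"
    by (simp add: tp_scale_def tp_const_mult algebra_simps)
  have us: "?u * ?s = 1"
    by (rule one_plus_var_geometric)
  have "witt_apply ?D (?X i * ?u) =
      (tp_scale (l $ i) (?X i) - tp_scale (l $ j * t) (?s * ?X j * ?X i)) * ?u +
      ?X i * tp_scale t (tp_scale (l $ j) (?X j))"
    using assms by (simp add: witt_apply_mult witt_apply_1_plus witt_apply_scale_right sheared_toral_var)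
  also have "\<dots> = tp_scale (l $ i) (?X i * ?u) - tp_scale (l $ j * t) ((?u * ?s) * (?X j * ?X i)) +
      tp_scale (l $ j * t) (?X j * ?X i)"
    by (rule expand)
  also have "\<dots> = tp_scale (l $ i) (?X i * ?u)"
    unfolding us by simp
  finally have Y: "witt_apply ?D (?X i * ?u) = tp_scale (l $ i) (?X i * ?u)" .
  have row: "const_row (witt_ppow ?D m) $ k = (l $ k) ^ (CHAR('k) ^ m)" if "k \<noteq> i" for m k
    using eigen[OF that] by (rule const_row_ppow_eigen)
  have row_i: "const_row (witt_ppow ?D m) $ i =
      (l $ i) ^ (CHAR('k) ^ m) - t * (l $ j) ^ (CHAR('k) ^ m)" for m
  proof -
    let ?E = "witt_ppow ?D m"
    have "witt_apply ?E (?X i * ?u) = tp_scale ((l $ i) ^ (CHAR('k) ^ m)) (?X i * ?u)"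
      unfolding witt_ppow.rep_eq by (rule derivation_funpow_eigen[OF Y])
    \<comment> \<open>The value at the origin is computed twice: by the eigenvalue, and below by the
      product rule.\<close>
    then have "tp_eval0 (witt_apply ?E (?X i * ?u)) = (l $ i) ^ (CHAR('k) ^ m)"
      by (simp add: tp_eval0_scale tp_eval0_mult tp_eval0_add tp_eval0_1 tp_eval0_var)
    moreover have "tp_eval0 (witt_apply ?E (?X i * ?u)) =
        const_row ?E $ i + t * const_row ?E $ j"
      by (simp add: witt_apply_mult witt_apply_1_plus witt_apply_scale_right const_row_def
          tp_eval0_scale tp_eval0_mult tp_eval0_add tp_eval0_1 tp_eval0_var)
    ultimately show ?thesis
      using row[of j m] assms by (simp add: algebra_simps)
  qed
  define M :: "(('k, 'n) vec, 'n) vec" where "M = (\<chi> k r. (l $ k) ^ (CHAR('k) ^ card {..<r}))"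
  have "(\<chi> k r. const_row (witt_ppow ?D (card {..<r})) $ k) =
      (\<chi> k. if k = i then row i M + (- t) *s row j M else row k M)"
    by (auto simp: vec_eq_iff M_def row_def row row_i)
  then have "Delta0 ?D = det M"
    unfolding Delta0_eq_det_transpose by (simp only: det_row_operation[OF assms])
  then show ?thesis
    by (simp add: moore_def M_def)
qed

lemma polyfun_sheared_toral:
  fixes l :: "'k::field_prime_char ^ 'n::finite"
  assumes "f \<in> polyfun witt_scale"
  obtains q where "\<And>t. f (sheared_toral l i j t) = poly q t"
proof -
  define v where "v = (\<lambda>m. case m of 0 \<Rightarrow> toral l | Suc m \<Rightarrow> - witt_scale (l $ j) (shear_term i j m))"
  have "sheared_toral l i j t = (\<Sum>m\<in>{..CHAR('k)}. witt_scale (t ^ m) (v m))" for t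
  proof -
    have "(\<Sum>m\<in>{..CHAR('k)}. witt_scale (t ^ m) (v m)) =
        toral l + (\<Sum>m<CHAR('k). witt_scale (t ^ Suc m) (- witt_scale (l $ j) (shear_term i j m)))"
      unfolding sum.atMost_shift by (simp add: v_def)
    then show ?thesis
      by (simp add: sheared_toral_def witt.scale_sum_right sum_negf mult.commute)
  qed
  then show ?thesis
    using polyfun_on_curve[OF assms, where I = "{..CHAR('k)}" and v = v] that by auto
qed

section \<open>Homogeneity and conclusion\<close>

lemma Delta0_scale:
  fixes D :: "('n::{finite, linorder}, 'k::field_prime_char) witt"
  shows "Delta0 (witt_scale s D) = s ^ (\<Sum>i\<in>(UNIV :: 'n set). CHAR('k) ^ card {..<i}) * Delta0 D"
proof -
  have funpow: "(witt_apply (witt_scale s D) ^^ m) f = tp_scale (s ^ m) ((witt_apply D ^^ m) f)" for m f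
    by (induction m) (simp_all add: witt_scale.rep_eq witt_apply_scale_right mult.commute)
  have "const_row (witt_ppow (witt_scale s D) m) = s ^ (CHAR('k) ^ m) *s const_row (witt_ppow D m)" for m
    by (simp add: vec_eq_iff const_row_def witt_ppow.rep_eq funpow tp_eval0_scale)
  then show ?thesis
    by (simp add: Delta0_eq_det det_rows_mul power_sum)
qed

text \<open>On the line through \<open>0\<close> and a point where \<open>Delta0\<close> is nonzero,
  the two factors multiply to a nonzero multiple of a power of \<open>s\<close>. The restriction of
  \<open>H\<close> can thus vanish only at s = 0, where its value is \<open>H 0\<close>; having no
  root, it is constant. Density gives the rest.\<close>

lemma Delta0_cofactor_constant:
  fixes G H :: "('n::{finite, linorder}, 'k::{alg_closed_field, field_prime_char}) witt \<Rightarrow> 'k"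
  assumes G: "G \<in> polyfun witt_scale" and H: "H \<in> polyfun witt_scale"
    and GH: "\<And>D. Delta0 D = G D * H D" and H0: "H 0 \<noteq> 0"
  shows "H D = H 0"
proof -
  have inf: "infinite (UNIV :: 'k set)"
    by (rule infinite_UNIV_alg_closed_field)
  obtain z :: "('k, 'n) vec" where "moore z \<noteq> 0"
    using moore_nonzero[OF inf] by blast
  then have z: "Delta0 (toral z) \<noteq> 0"
    by (simp add: Delta0_toral)
  have "H D = H 0" if D: "Delta0 D \<noteq> 0" for D
  proof -
    obtain g where g: "\<And>s. G (0 + witt_scale s D) = poly g s"
      using polyfun_on_line[OF witt.vector_space_axioms G, where x = 0 and y = D] by blast
    obtain h where h: "\<And>s. H (0 + witt_scale s D) = poly h s"
      using polyfun_on_line[OF witt.vector_space_axioms H, where x = 0 and y = D] by blast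
    define N where "N = (\<Sum>i\<in>(UNIV :: 'n set). CHAR('k) ^ card {..<i})"
    have "poly (g * h - Polynomial.monom (Delta0 D) N) s = 0" for s
      using GH[of "witt_scale s D"] g[of s] h[of s]
      by (simp add: Delta0_scale N_def poly_monom mult.commute)
    then have gh: "g * h = Polynomial.monom (Delta0 D) N"
      using infinite_poly_vanish[OF inf] by (metis eq_iff_diff_eq_0)
    have "degree h = 0"
    proof (rule ccontr)
      assume "degree h \<noteq> 0"
      then obtain x where x: "poly h x = 0"
        using alg_closed_imp_poly_has_root by blast
      then have "Delta0 D * x ^ N = 0"
        using arg_cong[OF gh, of "\<lambda>p. poly p x"] by (simp add: poly_monom)
      then have "x = 0"
        using D by simp
      then show False
        using x h[of 0] H0 by simp
    qed
    then obtain a where "h = [:a:]"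
      by (rule degree_eq_zeroE)
    then show ?thesis
      using h[of 0] h[of 1] by simp
  qed
  then show ?thesis
    by (rule polyfun_cong_of_dense[OF witt.vector_space_axioms inf H polyfun.const polyfun_Delta0 z])
qed

theorem mainTheorem5:
  assumes "CHAR('k::{alg_closed_field, field_prime_char}) > 2"
    and "(CHAR('k), CARD('n::{finite, linorder})) \<noteq> (3, 1)"
  shows "(Delta0 :: ('n, 'k) witt \<Rightarrow> 'k) \<in> carrier (polyfun_ring witt_scale) \<and>
         ring_irreducible\<^bsub>polyfun_ring witt_scale\<^esub> (Delta0 :: ('n, 'k) witt \<Rightarrow> 'k)"
proof
  have inf: "infinite (UNIV :: 'k set)"
    by (rule infinite_UNIV_alg_closed_field)
  show "(Delta0 :: ('n, 'k) witt \<Rightarrow> 'k) \<in> carrier (polyfun_ring witt_scale)"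
    using polyfun_Delta0 by (simp add: polyfun_ring_def)
  obtain z :: "('k, 'n) vec" where z: "moore z \<noteq> 0"
    using moore_nonzero[OF inf] by blast
  have toral_0: "toral 0 = (0 :: ('n, 'k) witt)"
    by (simp add: toral_def)
  show "ring_irreducible\<^bsub>polyfun_ring witt_scale\<^esub> (Delta0 :: ('n, 'k) witt \<Rightarrow> 'k)"
  proof (rule ring_irreducible_polyfunI)
    show "(Delta0 :: ('n, 'k) witt \<Rightarrow> 'k) \<in> polyfun witt_scale"
      by (rule polyfun_Delta0)
    show "Delta0 (toral z) \<noteq> 0"
      using z by (simp add: Delta0_toral)
    show "Delta0 (toral (0 :: ('k, 'n) vec)) = 0"
      unfolding Delta0_toral by (rule moore_eq_0) simp
  next
    fix G H :: "('n, 'k) witt \<Rightarrow> 'k"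
    assume G: "G \<in> polyfun witt_scale" and H: "H \<in> polyfun witt_scale"
      and GH: "\<And>D. Delta0 D = G D * H D"
    \<comment> \<open>Along the sheared curve the product of the factors is the nonzero constant
      \<open>moore l\<close>, so \<open>f\<close> has equal values at t = 1 and t = 0. The statement
      is symmetric in the factors in order to serve both.\<close>
    have invariant: "f (toral (l - (l $ j) *s axis i 1)) = f (toral l)"
      if f: "f \<in> polyfun witt_scale" and g: "g \<in> polyfun witt_scale"
        and fg: "\<And>D. Delta0 D = f D * g D" and ij: "i \<noteq> j" and l: "moore l \<noteq> 0"
      for f g :: "('n, 'k) witt \<Rightarrow> 'k" and i j l
    proof -
      obtain p where p: "\<And>t. f (sheared_toral l i j t) = poly p t"
        using polyfun_sheared_toral[OF f] by blast
      obtain q where q: "\<And>t. g (sheared_toral l i j t) = poly q t"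
        using polyfun_sheared_toral[OF g] by blast
      have "poly p t * poly q t = moore l" for t
        by (simp add: Delta0_sheared_toral[OF ij] flip: p q fg)
      from poly_factors_of_const[OF inf this l, of 1 0] show ?thesis
        by (simp add: sheared_toral_0 sheared_toral_1[OF ij] flip: p)
    qed
    have "(\<forall>l :: ('k, 'n) vec. G (toral l) = G (toral 0)) \<or>
        (\<forall>l :: ('k, 'n) vec. H (toral l) = H (toral 0))"
    proof (rule moore_factor_constant[OF inf])
      show "(\<lambda>l :: ('k, 'n) vec. G (toral l)) \<in> polyfun (*s)"
        "(\<lambda>l :: ('k, 'n) vec. H (toral l)) \<in> polyfun (*s)"
        by (rule polyfun_comp_linear[OF linear_toral G] polyfun_comp_linear[OF linear_toral H])+
      show "G (toral l) * H (toral l) = moore l" for l :: "('k, 'n) vec"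
        by (simp flip: GH add: Delta0_toral)
      show "G (toral (l - (l $ j) *s axis i 1)) = G (toral l) \<and>
          H (toral (l - (l $ j) *s axis i 1)) = H (toral l)"
        if "i \<noteq> j" "moore l \<noteq> 0" for i j and l :: "('k, 'n) vec"
        using invariant[OF G H GH that] invariant[OF H G _ that] GH by (simp add: mult.commute)
    qed
    \<comment> \<open>The factor that is constant on the torus is nonzero at \<open>toral z\<close>,
      hence also at \<open>0\<close>.\<close>
    moreover have "G (toral z) * H (toral z) \<noteq> 0"
      using z by (simp flip: GH add: Delta0_toral)
    ultimately have "G 0 \<noteq> 0 \<or> H 0 \<noteq> 0"
      unfolding toral_0 by auto
    then show "(\<exists>c. \<forall>D. G D = c) \<or> (\<exists>c. \<forall>D. H D = c)"
    proof
      assume "G 0 \<noteq> 0"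
      moreover have "Delta0 D = H D * G D" for D
        using GH by (simp add: mult.commute)
      ultimately show ?thesis
        using Delta0_cofactor_constant[OF H G] by blast
    next
      assume "H 0 \<noteq> 0"
      then show ?thesis
        using Delta0_cofactor_constant[OF G H GH] by blast
    qed
  qed
qed

end
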